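(* Let $\Gamma$ be a $4$-regular planar tessellation with non-negative combinatorial curvature ($\Phi(x)\ge0$ for all vertices $x$). Suppose that $\sup_{\sigma\in F}|\sigma|\ge 13$. Then $\Gamma$ is finite, i.e. embedded into $\mathbb S^2$, and $\Gamma$ is an antiprism.
   Context: A planar tessellation $G=(V,E,F)$ is a locally finite, connected, simple graph embedded in $\mathbb S^2$ or $\mathbb R^2$, with $F$ the set of faces, such that: (i) every closed face is a closed disk whose boundary consists of finitely many edges; (ii) every edge lies in exactly two different closed faces; (iii) two distinct closed faces intersect in the empty set, a single vertex, or the closure of a single edge; moreover all vertex degrees and face degrees $|\sigma|$ (numbers of boundary edges) are at least $3$. The combinatorial curvature at a vertex $x$ is $\Phi(x)=1-\frac{|x|}{2}+\sum_{\sigma}\frac{1}{|\sigma|}$, the sum over faces $\sigma$ whose closure contains $x$. $4$-regular means every vertex has degree $4$. An antiprism here means the tessellation of $\mathbb S^2$ given by the boundary of an $n$-gonal antiprism: two disjoint $n$-gons joined by a cyclic band of $2n$ triangles, every vertex being incident to one $n$-gon and three triangles. *)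

theory Defs
  imports "HOL-Analysis.Analysis" "HOL-Library.Extended_Nat"
begin

definition is_two_sphere :: "'a::euclidean_space set \<Rightarrow> bool" where
  "is_two_sphere S \<longleftrightarrow> DIM('a) = 3 \<and> S = sphere 0 1"

definition is_plane :: "'a::euclidean_space set \<Rightarrow> bool" where
  "is_plane S \<longleftrightarrow> DIM('a) = 2 \<and> S = UNIV"

text \<open>
  A graph embedded in a surface \<open>S\<close> is given by its set \<open>V\<close> of vertices (points of \<open>S\<close>) and its
  set \<open>E\<close> of edges; an edge is a closed arc, i.e. it contains its two endpoints.
  The set of endpoints of an edge \<open>e\<close> is then \<open>e \<inter> V\<close>.
\<close>

definition vertex_degree :: "'a set set \<Rightarrow> 'a \<Rightarrow> nat" where
  "vertex_degree E x = card {e \<in> E. x \<in> e}"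

definition adjacency :: "'a set \<Rightarrow> 'a set set \<Rightarrow> ('a \<times> 'a) set" where
  "adjacency V E = {(x, y). x \<noteq> y \<and> (\<exists>e\<in>E. e \<inter> V = {x, y})}"

definition faces :: "'a::euclidean_space set \<Rightarrow> 'a set \<Rightarrow> 'a set set \<Rightarrow> 'a set set" where
  "faces S V E = components (S - (V \<union> \<Union>E))"

definition closed_face :: "'a::euclidean_space set \<Rightarrow> 'a set \<Rightarrow> 'a set" where
  "closed_face S f = top_of_set S closure_of f"

definition face_boundary :: "'a::euclidean_space set \<Rightarrow> 'a set \<Rightarrow> 'a set" where
  "face_boundary S f = top_of_set S frontier_of (closed_face S f)"

definition boundary_edges :: "'a::euclidean_space set \<Rightarrow> 'a set set \<Rightarrow> 'a set \<Rightarrow> 'a set set" where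
  "boundary_edges S E f = {e \<in> E. e \<subseteq> face_boundary S f}"

definition face_degree :: "'a::euclidean_space set \<Rightarrow> 'a set set \<Rightarrow> 'a set \<Rightarrow> nat" where
  "face_degree S E f = card (boundary_edges S E f)"

locale embedded_graph =
  fixes S :: "'a::euclidean_space set" and V :: "'a set" and E :: "'a set set"
  assumes vertices_in_surface: "V \<subseteq> S"
    and edges_in_surface: "e \<in> E \<Longrightarrow> e \<subseteq> S"
    and edge_arc: "e \<in> E \<Longrightarrow>
          \<exists>g. arc g \<and> path_image g = e \<and> e \<inter> V = {pathstart g, pathfinish g}"
    and edges_meet_in_vertices: "\<lbrakk>e \<in> E; e' \<in> E; e \<noteq> e'\<rbrakk> \<Longrightarrow> e \<inter> e' \<subseteq> V"

text \<open>Loops are already excluded by \<open>edge_arc\<close>, so \<open>no_multiple_edges\<close> makes the graph simple.\<close>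

locale planar_tessellation = embedded_graph +
  assumes surface: "is_two_sphere S \<or> is_plane S"
    and no_multiple_edges: "inj_on (\<lambda>e. e \<inter> V) E"
    and locally_finite: "x \<in> V \<Longrightarrow> finite {e \<in> E. x \<in> e}"
    and connected_graph: "\<lbrakk>x \<in> V; y \<in> V\<rbrakk> \<Longrightarrow> (x, y) \<in> (adjacency V E)\<^sup>*"
    and closed_face_disk: "f \<in> faces S V E \<Longrightarrow>
          closed_face S f homeomorphic (cball 0 1 :: (real^2) set)"
    and face_boundary_edges: "f \<in> faces S V E \<Longrightarrow>
          finite (boundary_edges S E f) \<and> face_boundary S f = \<Union>(boundary_edges S E f)"
    and edge_in_two_faces: "e \<in> E \<Longrightarrow> card {f \<in> faces S V E. e \<subseteq> closed_face S f} = 2"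
    and faces_intersect: "\<lbrakk>f \<in> faces S V E; g \<in> faces S V E; f \<noteq> g\<rbrakk> \<Longrightarrow>
          closed_face S f \<inter> closed_face S g = {} \<or>
          (\<exists>v\<in>V. closed_face S f \<inter> closed_face S g = {v}) \<or>
          (\<exists>e\<in>E. closed_face S f \<inter> closed_face S g = e)"
    and vertex_degree_ge_3: "x \<in> V \<Longrightarrow> vertex_degree E x \<ge> 3"
    and face_degree_ge_3: "f \<in> faces S V E \<Longrightarrow> face_degree S E f \<ge> 3"

definition curvature :: "'a::euclidean_space set \<Rightarrow> 'a set \<Rightarrow> 'a set set \<Rightarrow> 'a \<Rightarrow> real" where
  "curvature S V E x = 1 - real (vertex_degree E x) / 2
     + (\<Sum>f \<in> {f \<in> faces S V E. x \<in> closed_face S f}. 1 / real (face_degree S E f))"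

text \<open>
  The boundary complex of the \<open>n\<close>-gonal antiprism, up to relabelling: the vertices of the two
  \<open>n\<close>-gons are \<open>a 0, \<dots>, a (n-1)\<close> and \<open>b 0, \<dots>, b (n-1)\<close> in cyclic order, and \<open>b i\<close> is joined to
  \<open>a i\<close> and \<open>a (i+1)\<close>. Edges and faces are given by their vertex sets; since the subgraph induced
  on each of the listed face sets is a cycle, these sets determine the boundary edges.
\<close>

definition is_antiprism :: "'a::euclidean_space set \<Rightarrow> 'a set \<Rightarrow> 'a set set \<Rightarrow> bool" where
  "is_antiprism S V E \<longleftrightarrow>
     planar_tessellation S V E \<and> is_two_sphere S \<and>
     (\<exists>n\<ge>3. \<exists>a b :: nat \<Rightarrow> 'a.
        inj_on a {..<n} \<and> inj_on b {..<n} \<and> a ` {..<n} \<inter> b ` {..<n} = {} \<and>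
        V = a ` {..<n} \<union> b ` {..<n} \<and>
        bij_betw (\<lambda>e. e \<inter> V) E
          (\<Union>i<n. {{a i, a (Suc i mod n)}, {b i, b (Suc i mod n)},
                   {a i, b i}, {a (Suc i mod n), b i}}) \<and>
        bij_betw (\<lambda>f. closed_face S f \<inter> V) (faces S V E)
          ({a ` {..<n}, b ` {..<n}} \<union>
           (\<Union>i<n. {{a i, a (Suc i mod n), b i},
                    {a (Suc i mod n), b i, b (Suc i mod n)}})))"

end

theory Submission imports Defs begin

text \<open>
  By invariance of domain, the boundary of a closed face is a circle, and its open disk misses the
  graph; hence each vertex of the boundary lies on exactly two boundary edges. Double counting
  then puts exactly four faces at each vertex, and nonnegative curvature forces the three other
  faces at a vertex of a face \<open>\<sigma>\<close> with at least \<open>13\<close> edges to be triangles, as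
  \<open>1/13 + 1/4 + 1/3 + 1/3 < 1\<close>. The triangles over the edges of \<open>\<sigma>\<close> and the remaining triangles
  at its vertices form a band, and around an outer vertex of the band one face is left. Consecutive
  outer vertices have the same remaining face, so the band and two faces exhaust the tessellation.
  Finitely many compact faces cover the surface, which is therefore not the plane.
\<close>

section \<open>Four-regular complexes with a big face\<close>

text \<open>The hypotheses give no cyclic order of edges or faces around a vertex. Counting replaces
  it: two faces share at most two vertices, hence at most one edge at any given vertex, and with
  degree 4 three consecutive faces at a vertex determine the fourth. The combinatorics thus needs
  only end sets of edges and abstract boundaries, collected in \<open>four_regular_complex\<close>.
  Apart from the final compactness argument, topology serves to verify those axioms. The difficulty
  there is that \<open>face_boundary\<close> is a frontier taken in the surface, while the disk
  hypothesis is an abstract homeomorphism that says nothing about the surrounding surface. The bound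
  13 is the least that the curvature estimate allows: 1/12 + 1/4 + 1/3 + 1/3 = 1, so a 12-gon may
  meet a quadrilateral at a vertex of curvature 0. Cyclic sequences are functions on all naturals
  with period \<open>n\<close>; this avoids modular indices until the final description.\<close>

lemma card_2_cases:
  assumes "card A = 2" "a \<in> A" "b \<in> A" "a \<noteq> b" "c \<in> A"
  shows "c = a \<or> c = b"
  using assms by (auto simp: card_2_iff)

lemma card_2_other:
  assumes "card A = 2"
  shows "\<exists>b\<in>A. b \<noteq> a"
  using assms by (auto simp: card_2_iff)

text \<open>Walk through \<open>C\<close> without turning back. As \<open>C\<close> is finite a
  vertex is repeated, and the first repetition is a return to the start. The cycle need not exhaust
  \<open>C\<close>; for face boundaries that is supplied by \<open>bd_cycle\<close>.\<close>

lemma two_regular_cycle: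
  fixes N :: "'v \<Rightarrow> 'v set"
  assumes "finite C" "C \<noteq> {}"
    and N_sub: "\<And>v. v \<in> C \<Longrightarrow> N v \<subseteq> C"
    and N_card: "\<And>v. v \<in> C \<Longrightarrow> card (N v) = 2"
    and N_irrefl: "\<And>v. v \<in> C \<Longrightarrow> v \<notin> N v"
    and N_sym: "\<And>u v. v \<in> C \<Longrightarrow> u \<in> N v \<Longrightarrow> v \<in> N u"
  obtains n a where "n \<ge> 3" "inj_on a {..<n}" "\<And>i::nat. a (i mod n) = a i"
    "\<And>i. a (Suc i) \<in> N (a i)" "\<And>i. a i \<in> C" "\<And>i. a i \<noteq> a (Suc (Suc i))"
proof -
  obtain v where v: "v \<in> C"
    using assms(2) by blast
  obtain u where u: "u \<in> N v"
    using card_2_other[OF N_card[OF v]] by blast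
  \<comment> \<open>The states are pairs of consecutive vertices, so that not turning back becomes a
    condition \<open>Q\<close> on two successive states.\<close>
  define P where "P = (\<lambda>p. fst p \<in> C \<and> snd p \<in> N (fst p))"
  define Q where "Q = (\<lambda>p q :: 'v \<times> 'v. fst q = snd p \<and> snd q \<noteq> fst p)"
  have "\<exists>s. s 0 = (v, u) \<and> (\<forall>i. P (s i) \<and> Q (s i) (s (Suc i)))"
  proof (rule dependent_nat_choice[where P = "\<lambda>n p. (n = 0 \<longrightarrow> p = (v, u)) \<and> P p" and Q = "\<lambda>n. Q", THEN ex_forward], goal_cases)
    case 1
    show ?case
      using u v by (auto simp: P_def)
  next
    case (2 p n)
    then have "snd p \<in> C"
      using N_sub by (auto simp: P_def)
    then obtain w where "w \<in> N (snd p)" "w \<noteq> fst p"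
      using card_2_other[OF N_card] by blast
    then show ?case
      using \<open>snd p \<in> C\<close> by (intro exI[of _ "(snd p, w)"]) (auto simp: P_def Q_def)
  next
    case (3 s)
    then show ?case
      by blast
  qed
  then obtain s where s: "\<And>i. P (s i)" "\<And>i. Q (s i) (s (Suc i))"
    by blast
  define c where "c = (\<lambda>i. fst (s i))"
  have cC: "c i \<in> C" for i
    using s(1)[of i] by (simp add: c_def P_def)
  have cN: "c (Suc i) \<in> N (c i)" for i
    using s(1)[of i] s(2)[of i] by (simp add: c_def P_def Q_def)
  have c2: "c (Suc (Suc i)) \<noteq> c i" for i
    using s(2)[of i] s(2)[of "Suc i"] by (simp add: c_def Q_def)
  have c1: "c (Suc i) \<noteq> c i" for i
    using cN[of i] N_irrefl[OF cC[of i]] by auto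
  have cN': "c i \<in> N (c (Suc i))" for i
    using N_sym cN cC by blast
  have "\<not> inj c"
    using finite_subset[of "range c" C] assms(1) cC finite_imageD[of c UNIV] by auto
  then obtain j0 i0 where "i0 < j0" "c j0 = c i0"
    unfolding inj_def by (metis linorder_neqE_nat)
  define j where "j = (LEAST j. \<exists>i<j. c j = c i)"
  have "\<exists>i<j. c j = c i"
    unfolding j_def by (rule LeastI[where k = j0]) (use \<open>i0 < j0\<close> \<open>c j0 = c i0\<close> in blast)
  then obtain i where i: "i < j" "c j = c i"
    by blast
  have distinct: "c k \<noteq> c l" if "l < k" "k < j" for k l
    using not_less_Least[of k "\<lambda>j. \<exists>i<j. c j = c i"] that unfolding j_def by blast
  have "j \<noteq> Suc i" "j \<noteq> Suc (Suc i)"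
    using c1[of i] c2[of i] i(2) by auto
  with i(1) have j3: "i + 3 \<le> j"
    by linarith
  obtain m where m: "j = Suc m"
    using j3 by (metis add_leE le_Suc_ex add_Suc numeral_3_eq_3 add_Suc_right)
  \<comment> \<open>Otherwise \<open>c l\<close>, \<open>c (Suc i)\<close> and \<open>c m\<close>
    are all neighbours of \<open>c i\<close>, which has only two; then \<open>c m\<close> repeats an
    earlier vertex, against the minimality of \<open>j\<close>.\<close>
  have "i = 0"
  proof (rule ccontr)
    assume "i \<noteq> 0"
    then obtain l where l: "i = Suc l"
      using not0_implies_Suc by blast
    have "c m \<in> N (c i)"
      using cN'[of m] i(2) m by simp
    then have "c m = c l \<or> c m = c (Suc i)"
      using card_2_cases[OF N_card[OF cC[of i]] _ cN[of i]] cN'[of l] c2[of l] l by metis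
    then show False
      using distinct[of l m] distinct[of "Suc i" m] m j3 l by auto
  qed
  define a where "a = (\<lambda>k. c (k mod j))"
  have jpos: "j > 0"
    using j3 by simp
  have a_Suc: "a (Suc k) = c (Suc (k mod j))" for k
  proof (cases "Suc (k mod j) = j")
    case True
    then show ?thesis
      using i(2) \<open>i = 0\<close> by (simp add: a_def mod_Suc)
  next
    case False
    then show ?thesis
      by (simp add: a_def mod_Suc)
  qed
  show thesis
  proof (rule that[of j a])
    show "j \<ge> 3"
      using j3 by simp
    show "inj_on a {..<j}"
      by (rule linorder_inj_onI') (use distinct in \<open>force simp: a_def\<close>)
    show "a (k mod j) = a k" for k
      by (simp add: a_def)
    show "a (Suc k) \<in> N (a k)" for k
      using cN[of "k mod j"] by (simp add: a_Suc) (simp add: a_def)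
    show "a k \<in> C" for k
      by (simp add: a_def cC)
    show "a k \<noteq> a (Suc (Suc k))" for k
    proof (cases "Suc (k mod j) = j")
      case True
      then have "a (Suc (Suc k)) = c 1" "a k = c m"
        using m j3 by (auto simp: a_Suc mod_Suc a_def)
      then show ?thesis
        using distinct[of 1 m] j3 m by auto
    next
      case False
      then have "a (Suc (Suc k)) = c (Suc (Suc (k mod j)))"
        by (simp add: a_Suc mod_Suc)
      then show ?thesis
        using c2[of "k mod j"] by (simp add: a_def)
    qed
  qed
qed

text \<open>Edges are two-element vertex sets and faces are mere labels with a set of boundary
  edges. \<open>bd_vertex\<close> and \<open>bd_connected\<close> together say that a boundary is a
  single cycle. \<open>faces_meet\<close> keeps from the intersection axiom only the number of
  common vertices.\<close>

locale four_regular_complex =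
  fixes V :: "'v set" and G :: "'v set set" and F :: "'f set" and bd :: "'f \<Rightarrow> 'v set set"
  assumes edge_sub: "e \<in> G \<Longrightarrow> e \<subseteq> V"
    and edge_card: "e \<in> G \<Longrightarrow> card e = 2"
    and degree: "x \<in> V \<Longrightarrow> card {e \<in> G. x \<in> e} = 4"
    and graph_connected: "x \<in> V \<Longrightarrow> y \<in> V \<Longrightarrow> (x, y) \<in> {(x, y). {x, y} \<in> G}\<^sup>*"
    and bd_sub: "f \<in> F \<Longrightarrow> bd f \<subseteq> G"
    and bd_finite: "f \<in> F \<Longrightarrow> finite (bd f)"
    and bd_nonempty: "f \<in> F \<Longrightarrow> bd f \<noteq> {}"
    and bd_vertex: "f \<in> F \<Longrightarrow> x \<in> \<Union>(bd f) \<Longrightarrow> card {e \<in> bd f. x \<in> e} = 2"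
    and bd_connected: "f \<in> F \<Longrightarrow> A \<subseteq> bd f \<Longrightarrow> A \<noteq> {} \<Longrightarrow>
      (\<And>e e'. e \<in> A \<Longrightarrow> e' \<in> bd f \<Longrightarrow> e \<inter> e' \<noteq> {} \<Longrightarrow> e' \<in> A) \<Longrightarrow> A = bd f"
    and two_faces: "e \<in> G \<Longrightarrow> card {f \<in> F. e \<in> bd f} = 2"
    and faces_meet: "f \<in> F \<Longrightarrow> g \<in> F \<Longrightarrow> f \<noteq> g \<Longrightarrow> card (\<Union>(bd f) \<inter> \<Union>(bd g)) \<le> 2"
begin

section \<open>Incidences of vertices, edges and faces\<close>

lemma edgeD:
  assumes "f \<in> F" "{x, y} \<in> bd f"
  shows "{x, y} \<in> G" "x \<noteq> y" "x \<in> V" "y \<in> V"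
proof -
  show *: "{x, y} \<in> G"
    using assms bd_sub by blast
  show "x \<noteq> y" "x \<in> V" "y \<in> V"
    using edge_card[OF *] edge_sub[OF *] by (auto simp: card_insert_if split: if_splits)
qed

lemma edge_other_end:
  assumes "e \<in> G" "x \<in> e"
  obtains y where "y \<noteq> x" "e = {x, y}"
proof -
  obtain y z where "e = {y, z}" "y \<noteq> z"
    using edge_card[OF assms(1)] by (auto simp: card_2_iff)
  then show thesis
    using that[of y] that[of z] assms(2) by (auto simp: insert_commute)
qed

lemma finite_vertices_of_face:
  assumes "f \<in> F"
  shows "finite (\<Union>(bd f))"
  using assms bd_finite bd_sub edge_card
  by (metis (no_types, lifting) card.infinite finite_Union subset_eq zero_neq_numeral)

lemma bd_cases:
  assumes "f \<in> F" "p \<in> bd f" "q \<in> bd f" "p \<noteq> q" "x \<in> p" "x \<in> q" "e \<in> bd f" "x \<in> e"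
  shows "e = p \<or> e = q"
proof (rule card_2_cases)
  show "card {e \<in> bd f. x \<in> e} = 2"
    using bd_vertex[of f x] assms by blast
qed (use assms in auto)

lemma bd_other:
  assumes "f \<in> F" "p \<in> bd f" "x \<in> p"
  obtains q where "q \<in> bd f" "q \<noteq> p" "x \<in> q"
  using card_2_other[OF bd_vertex[of f x], of p] assms by blast

lemma face_cases:
  assumes "f \<in> F" "g \<in> F" "f \<noteq> g" "e \<in> bd f" "e \<in> bd g" "h \<in> F" "e \<in> bd h"
  shows "h = f \<or> h = g"
proof (rule card_2_cases)
  show "card {f \<in> F. e \<in> bd f} = 2"
    using two_faces[of e] assms bd_sub by blast
qed (use assms in auto)

lemma face_other:
  assumes "e \<in> G"
  obtains g where "g \<in> F" "g \<noteq> f" "e \<in> bd g"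
  using card_2_other[OF two_faces[OF assms], of f] by blast

lemma faces_eqI:
  assumes "f \<in> F" "g \<in> F" "{x, y, z} \<subseteq> \<Union>(bd f)" "{x, y, z} \<subseteq> \<Union>(bd g)" "x \<noteq> y" "x \<noteq> z" "y \<noteq> z"
  shows "f = g"
proof (rule ccontr)
  assume "f \<noteq> g"
  then have "card (\<Union>(bd f) \<inter> \<Union>(bd g)) \<le> 2"
    using faces_meet assms by blast
  moreover have "card {x, y, z} \<le> card (\<Union>(bd f) \<inter> \<Union>(bd g))"
    using assms(1,3,4) by (intro card_mono finite_Int) (auto simp: finite_vertices_of_face)
  ultimately show False
    using assms by simp
qed

text \<open>Two different edges with a common end have three vertices between them, more than two
  faces may share. This is the substitute for planarity in the analysis of a vertex.\<close>

lemma common_edge_unique: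
  assumes "f \<in> F" "g \<in> F" "f \<noteq> g" "p \<in> bd f" "p \<in> bd g" "q \<in> bd f" "q \<in> bd g" "x \<in> p" "x \<in> q"
  shows "p = q"
proof (rule ccontr)
  assume "p \<noteq> q"
  obtain y where y: "y \<noteq> x" "p = {x, y}"
    using edge_other_end[of p x] assms bd_sub by blast
  obtain z where z: "z \<noteq> x" "q = {x, z}"
    using edge_other_end[of q x] assms bd_sub by blast
  have "f = g"
  proof (rule faces_eqI[OF assms(1,2)])
    show "{x, y, z} \<subseteq> \<Union>(bd f)" "{x, y, z} \<subseteq> \<Union>(bd g)"
      using assms(4-7) y(2) z(2) by blast+
  qed (use y z \<open>p \<noteq> q\<close> in auto)
  then show False
    using assms by blast
qed

text \<open>Two successive boundary edges already contain three vertices, which determine the face.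
  Faces may therefore be replaced by their vertex sets, as \<open>is_antiprism\<close> does.\<close>

lemma vertices_inj: "inj_on (\<lambda>f. \<Union>(bd f)) F"
proof (rule inj_onI)
  fix f g assume f: "f \<in> F" and g: "g \<in> F" and eq: "\<Union>(bd f) = \<Union>(bd g)"
  obtain p where p: "p \<in> bd f"
    using bd_nonempty[OF f] by blast
  have G: "e \<in> G" if "e \<in> bd f" for e
    using bd_sub[OF f] that by blast
  obtain x y where y: "y \<noteq> x" "p = {x, y}"
    using edge_card[OF G[OF p]] by (metis card_2_iff)
  obtain q where q: "q \<in> bd f" "q \<noteq> p" "x \<in> q"
    by (rule bd_other[OF f p, of x]) (simp add: y)
  obtain z where z: "z \<noteq> x" "q = {x, z}"
    by (rule edge_other_end[OF G[OF q(1)] q(3)])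
  have sub: "{x, y, z} \<subseteq> \<Union>(bd f)"
    using p q(1) y(2) z(2) by blast
  show "f = g"
    by (rule faces_eqI[OF f g sub sub[unfolded eq]]) (use q(2) y z in auto)
qed

lemma edges_at_vertex:
  assumes "{p, q, r, s} \<subseteq> G" "x \<in> p \<inter> q \<inter> r \<inter> s" "card {p, q, r, s} = 4"
  shows "{e \<in> G. x \<in> e} = {p, q, r, s}"
proof -
  have "x \<in> V"
    using assms(1,2) edge_sub by blast
  then have "card {e \<in> G. x \<in> e} = 4"
    by (rule degree)
  moreover have "{p, q, r, s} \<subseteq> {e \<in> G. x \<in> e}"
    using assms(1,2) by blast
  ultimately show ?thesis
    using assms(3) by (metis card.infinite card_subset_eq zero_neq_numeral)
qed

text \<open>The faces \<open>f\<close>, \<open>g\<close>, \<open>h\<close> form a fan at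
  \<open>x\<close>, separated by \<open>q\<close> and \<open>r\<close> and bounded by
  \<open>p\<close> and \<open>s\<close>. The fan cannot close up after three faces because a fourth
  edge at \<open>x\<close> would have no face left, and the gap between \<open>p\<close> and
  \<open>s\<close> is filled by one face.\<close>

lemma fourth_face:
  assumes F: "f \<in> F" "g \<in> F" "h \<in> F" "f \<noteq> g" "g \<noteq> h" "f \<noteq> h"
    and bds: "p \<in> bd f" "q \<in> bd f" "q \<in> bd g" "r \<in> bd g" "r \<in> bd h" "s \<in> bd h"
    and x: "x \<in> p" "x \<in> q" "x \<in> r" "x \<in> s"
    and ne: "p \<noteq> q" "q \<noteq> r" "r \<noteq> s"
  shows "p \<noteq> s" "{e \<in> G. x \<in> e} = {p, q, r, s}"
    "\<exists>k\<in>F. k \<noteq> f \<and> k \<noteq> g \<and> k \<noteq> h \<and> p \<in> bd k \<and> s \<in> bd k"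
proof -
  have G: "p \<in> G" "q \<in> G" "r \<in> G" "s \<in> G"
    using F bds bd_sub by blast+
  have pr: "p \<noteq> r"
    using common_edge_unique[of f g p q x] F bds x ne by blast
  have qs: "q \<noteq> s"
    using common_edge_unique[of g h q r x] F bds x ne by blast
  have f_at: "e = p \<or> e = q" if "e \<in> bd f" "x \<in> e" for e
    using bd_cases[of f p q x e] F bds x ne that by blast
  have g_at: "e = q \<or> e = r" if "e \<in> bd g" "x \<in> e" for e
    using bd_cases[of g q r x e] F bds x ne that by blast
  have h_at: "e = r \<or> e = s" if "e \<in> bd h" "x \<in> e" for e
    using bd_cases[of h r s x e] F bds x ne that by blast
  have q_in: "k = f \<or> k = g" if "k \<in> F" "q \<in> bd k" for k
    using face_cases[of f g q k] F bds that by blast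
  have r_in: "k = g \<or> k = h" if "k \<in> F" "r \<in> bd k" for k
    using face_cases[of g h r k] F bds that by blast
  show ps: "p \<noteq> s"
  proof
    assume [simp]: "p = s"
    have p_in: "k = f \<or> k = h" if "k \<in> F" "p \<in> bd k" for k
      using face_cases[of f h p k] F bds that by auto
    have "\<not> {e \<in> G. x \<in> e} \<subseteq> {p, q, r}"
    proof
      assume "{e \<in> G. x \<in> e} \<subseteq> {p, q, r}"
      from card_mono[OF _ this] degree[of x] show False
        using G(1) x(1) edge_sub[of p] by (auto simp: card_insert_if split: if_splits)
    qed
    then obtain d where d: "d \<in> G" "x \<in> d" "d \<noteq> p" "d \<noteq> q" "d \<noteq> r"
      by blast
    obtain k where k: "k \<in> F" "d \<in> bd k"
      using face_other[OF d(1), of undefined] by blast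
    obtain c where c: "c \<in> bd k" "c \<noteq> d" "x \<in> c"
      using bd_other[OF k d(2)] by blast
    have "{e \<in> G. x \<in> e} = {p, q, r, d}"
      by (rule edges_at_vertex) (use G d x ne pr in auto)
    then have "c = p \<or> c = q \<or> c = r"
      using c bd_sub[OF k(1)] by blast
    then have "k = f \<or> k = g \<or> k = h"
      using p_in q_in r_in c k by blast
    then show False
      using f_at[of d] g_at[of d] h_at[of d] d k by auto
  qed
  show all: "{e \<in> G. x \<in> e} = {p, q, r, s}"
    by (rule edges_at_vertex) (use G x ne pr qs ps in auto)
  obtain k where k: "k \<in> F" "k \<noteq> f" "p \<in> bd k"
    using face_other[OF G(1), of f] by blast
  obtain c where c: "c \<in> bd k" "c \<noteq> p" "x \<in> c"
    using bd_other[OF k(1,3) x(1)] by blast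
  have kg: "k \<noteq> g"
    using g_at[of p] k x ne pr by blast
  have kh: "k \<noteq> h"
    using h_at[of p] k x ps pr by blast
  have "c \<in> {p, q, r, s}"
    using all c bd_sub[OF k(1)] by blast
  \<comment> \<open>The two faces at \<open>q\<close> are \<open>f\<close> and \<open>g\<close>,
    those at \<open>r\<close> are \<open>g\<close> and \<open>h\<close>, and \<open>k\<close> is
    none of them.\<close>
  then have "c = s"
    using c q_in[of k] r_in[of k] k kg kh by blast
  then show "\<exists>k\<in>F. k \<noteq> f \<and> k \<noteq> g \<and> k \<noteq> h \<and> p \<in> bd k \<and> s \<in> bd k"
    using k kg kh c by blast
qed

text \<open>The second boundary edges at \<open>y\<close> and at \<open>z\<close> both differ from
  the two given edges, so both are the third one.\<close>

lemma triangle_bd: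
  assumes "f \<in> F" "card (bd f) = 3" "{x, y} \<in> bd f" "{x, z} \<in> bd f" "y \<noteq> z"
  shows "bd f = {{x, y}, {x, z}, {y, z}}"
proof -
  have ne: "x \<noteq> y" "x \<noteq> z"
    using edgeD assms by blast+
  obtain p where p: "p \<in> bd f" "p \<noteq> {x, y}" "y \<in> p"
    using bd_other[of f "{x, y}" y] assms by blast
  obtain q where q: "q \<in> bd f" "q \<noteq> {x, z}" "z \<in> q"
    using bd_other[of f "{x, z}" z] assms by blast
  have pz: "p \<noteq> {x, z}" and qy: "q \<noteq> {x, y}"
    using p q ne assms(5) by auto
  have xyz: "{x, y} \<noteq> {x, z}"
    using assms(5) by (metis doubleton_eq_iff)
  have eq: "bd f = {{x, y}, {x, z}, p}"
  proof (rule card_subset_eq[symmetric])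
    show "card {{x, y}, {x, z}, p} = card (bd f)"
      using assms(2) xyz pz p(2) by simp
  qed (use assms p bd_finite in auto)
  then have "q = p"
    using q qy by blast
  then obtain w where "p = {y, w}"
    using edge_other_end[of p y] p bd_sub[OF assms(1)] by blast
  with \<open>q = p\<close> have "p = {y, z}"
    using q(3) assms(5) by auto
  then show ?thesis
    using eq by simp
qed

lemma triangle_on_edge:
  assumes "f \<in> F" "card (bd f) = 3" "{x, y} \<in> bd f"
  obtains z where "z \<noteq> x" "z \<noteq> y" "bd f = {{x, y}, {x, z}, {y, z}}"
proof -
  obtain q where q: "q \<in> bd f" "q \<noteq> {x, y}" "x \<in> q"
    using bd_other[of f "{x, y}" x] assms by blast
  then obtain z where z: "z \<noteq> x" "q = {x, z}"
    using edge_other_end[of q x] bd_sub[OF assms(1)] by blast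
  then have "z \<noteq> y"
    using q by blast
  then show thesis
    using that[of z] triangle_bd[OF assms] z q by blast
qed

text \<open>A walk that never turns back uses both boundary edges at each vertex it leaves behind,
  so its edges are closed under adjacency in \<open>bd f\<close>. The last hypothesis supplies a
  predecessor to the vertex with index 0.\<close>

lemma bd_cycle:
  assumes "f \<in> F" "\<And>i::nat. {c i, c (Suc i)} \<in> bd f" "\<And>i. c i \<noteq> c (Suc (Suc i))"
    "\<And>i. \<exists>j. c i = c (Suc j)"
  shows "bd f = range (\<lambda>i. {c i, c (Suc i)})"
proof (rule bd_connected[symmetric])
  fix e e' assume "e \<in> range (\<lambda>i. {c i, c (Suc i)})" and e': "e' \<in> bd f" "e \<inter> e' \<noteq> {}"
  then obtain j where "c j \<in> e'"
    by auto
  then obtain i where i: "c (Suc i) \<in> e'"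
    using assms(4)[of j] by auto
  have "{c i, c (Suc i)} \<noteq> {c (Suc i), c (Suc (Suc i))}"
    using assms(3)[of i] by (auto simp: doubleton_eq_iff)
  then have "e' = {c i, c (Suc i)} \<or> e' = {c (Suc i), c (Suc (Suc i))}"
    using bd_cases[of f _ _ "c (Suc i)" e'] assms(1,2) e' i by blast
  then show "e' \<in> range (\<lambda>i. {c i, c (Suc i)})"
    by blast
qed (use assms in auto)

text \<open>Incident pairs of an edge and a face at \<open>x\<close> are counted twice: each edge is
  on two of the faces, each face uses two of the edges.\<close>

lemma card_faces_at_vertex:
  assumes "x \<in> V"
  shows "card {f \<in> F. x \<in> \<Union>(bd f)} = 4"
proof -
  let ?E = "{e \<in> G. x \<in> e}" and ?F = "{f \<in> F. x \<in> \<Union>(bd f)}"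
  have E4: "card ?E = 4"
    using degree assms by blast
  then have finE: "finite ?E"
    by (metis card.infinite zero_neq_numeral)
  have fin: "finite {f \<in> F. e \<in> bd f}" if "e \<in> G" for e
    using two_faces[OF that] by (metis card.infinite zero_neq_numeral)
  have "?F \<subseteq> (\<Union>e\<in>?E. {f \<in> F. e \<in> bd f})"
    using bd_sub by blast
  then have finF: "finite ?F"
    using finE fin by (auto intro: finite_subset[OF _ finite_UN_I])
  have "(\<Sum>f\<in>?F. card {e \<in> ?E. e \<in> bd f}) = 2 * card ?E"
  proof (rule sum_multicount[OF finF finE], rule ballI)
    fix e assume "e \<in> ?E"
    then have "{f \<in> ?F. e \<in> bd f} = {f \<in> F. e \<in> bd f}"
      by blast
    then show "card {f \<in> ?F. e \<in> bd f} = 2"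
      using two_faces \<open>e \<in> ?E\<close> by simp
  qed
  moreover have "card {e \<in> ?E. e \<in> bd f} = 2" if "f \<in> ?F" for f
  proof -
    have "{e \<in> ?E. e \<in> bd f} = {e \<in> bd f. x \<in> e}"
      using that bd_sub by blast
    then show ?thesis
      using bd_vertex[of f x] that by auto
  qed
  ultimately have "2 * card ?F = 2 * card ?E"
    by simp
  then show ?thesis
    using E4 by simp
qed

text \<open>The vertices of \<open>\<sigma>\<close> are the \<open>a i\<close>. \<open>T i\<close>
  is the triangle over the edge from \<open>a i\<close> to \<open>a (Suc i)\<close> with apex
  \<open>b i\<close>, \<open>U i\<close> is the triangle at \<open>a (Suc i)\<close> between
  \<open>T i\<close> and \<open>T (Suc i)\<close>, and \<open>W\<close> is the face beyond the band.
  Curvature enters only through the assumption on the faces that touch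
  \<open>\<sigma>\<close>.\<close>

lemma antiprism_structure:
  assumes \<sigma>: "\<sigma> \<in> F"
    and triangles: "\<And>f. f \<in> F \<Longrightarrow> f \<noteq> \<sigma> \<Longrightarrow> \<Union>(bd f) \<inter> \<Union>(bd \<sigma>) \<noteq> {} \<Longrightarrow> card (bd f) = 3"
  obtains n a b where "n \<ge> (3::nat)" "inj_on a {..<n}" "inj_on b {..<n}" "a ` {..<n} \<inter> b ` {..<n} = {}"
    "V = a ` {..<n} \<union> b ` {..<n}"
    "G = (\<Union>i<n. {{a i, a (Suc i mod n)}, {b i, b (Suc i mod n)}, {a i, b i}, {a (Suc i mod n), b i}})"
    "(\<lambda>f. \<Union>(bd f)) ` F = {a ` {..<n}, b ` {..<n}} \<union>
       (\<Union>i<n. {{a i, a (Suc i mod n), b i}, {a (Suc i mod n), b i, b (Suc i mod n)}})"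
proof -
  let ?N = "\<lambda>v. {u. {u, v} \<in> bd \<sigma>}"
  obtain n a where n: "n \<ge> 3" and inj_a: "inj_on a {..<n}" and a_mod: "\<And>i::nat. a (i mod n) = a i"
    and aN: "\<And>i. a (Suc i) \<in> ?N (a i)" and a2: "\<And>i. a i \<noteq> a (Suc (Suc i))"
  proof (rule two_regular_cycle[of "\<Union>(bd \<sigma>)" ?N])
    show "finite (\<Union>(bd \<sigma>))"
      by (rule finite_vertices_of_face[OF \<sigma>])
    show "\<Union>(bd \<sigma>) \<noteq> {}"
      using bd_nonempty[OF \<sigma>] bd_sub[OF \<sigma>] edge_card by fastforce
    fix v assume v: "v \<in> \<Union>(bd \<sigma>)"
    have "bij_betw (\<lambda>u. {u, v}) (?N v) {e \<in> bd \<sigma>. v \<in> e}"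
    proof (rule bij_betw_imageI)
      show "inj_on (\<lambda>u. {u, v}) (?N v)"
        by (auto simp: inj_on_def doubleton_eq_iff)
      show "(\<lambda>u. {u, v}) ` ?N v = {e \<in> bd \<sigma>. v \<in> e}"
      proof safe
        fix e assume e: "e \<in> bd \<sigma>" "v \<in> e"
        then obtain u where "e = {v, u}"
          using edge_other_end[of e v] bd_sub[OF \<sigma>] by blast
        then show "e \<in> (\<lambda>u. {u, v}) ` ?N v"
          using e by (auto simp: insert_commute)
      qed
    qed
    then show "card (?N v) = 2"
      using bd_vertex[OF \<sigma> v] bij_betw_same_card by fastforce
    show "v \<notin> ?N v"
      using edgeD(2)[OF \<sigma>] by blast
    show "?N v \<subseteq> \<Union>(bd \<sigma>)"
      by blast
    show "v \<in> ?N u" if "u \<in> ?N v" for u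
      using that by (simp add: insert_commute)
  qed blast
  have a_edge: "{a i, a (Suc i)} \<in> bd \<sigma>" for i
    using aN[of i] by (simp add: insert_commute)
  have a1: "a i \<noteq> a (Suc i)" "a (Suc i) \<noteq> a i" for i
    using edgeD(2)[OF \<sigma> a_edge[of i]] by simp_all
  have a_period: "a (i + n) = a i" for i
    by (metis a_mod mod_add_self2)
  have a_eq: "i mod n = j mod n" if "a i = a j" for i j
  proof (rule inj_onD[OF inj_a])
    show "a (i mod n) = a (j mod n)"
      using that by (simp add: a_mod)
  qed (use n in auto)
  obtain m where m: "n = Suc m"
    using n by (cases n) auto
  have a_pred: "\<exists>j. a i = a (Suc j)" for i
    using a_period[of i] m by (metis add_Suc_right)
  have bd_\<sigma>: "bd \<sigma> = range (\<lambda>i. {a i, a (Suc i)})"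
    using bd_cycle[OF \<sigma> a_edge a2 a_pred] .
  then have verts_\<sigma>: "\<Union>(bd \<sigma>) = range a"
    using a_pred by auto
  have tri: "card (bd f) = 3" if "f \<in> F" "f \<noteq> \<sigma>" "e \<in> bd f" "a i \<in> e" for f e i
    using triangles[OF that(1,2)] that(3,4) verts_\<sigma> by blast
  define R where "R = (\<lambda>x y (z, t). t \<in> F \<and> t \<noteq> \<sigma> \<and> z \<notin> range a \<and> bd t = {{x, y}, {x, z}, {y, z}})"
  have "\<exists>p. R (a i) (a (Suc i)) p" for i
  proof -
    obtain t where t: "t \<in> F" "t \<noteq> \<sigma>" "{a i, a (Suc i)} \<in> bd t"
      using face_other edgeD(1)[OF \<sigma> a_edge] by metis
    then obtain z where z: "z \<noteq> a i" "z \<noteq> a (Suc i)"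
        "bd t = {{a i, a (Suc i)}, {a i, z}, {a (Suc i), z}}"
      using triangle_on_edge[of t "a i" "a (Suc i)"] tri by blast
    \<comment> \<open>An apex on \<open>\<sigma>\<close> would give \<open>t\<close> and
      \<open>\<sigma>\<close> three common vertices.\<close>
    have "z \<notin> range a"
    proof
      assume "z \<in> range a"
      then have "t = \<sigma>"
        using z a1[of i] t \<sigma> verts_\<sigma> by (intro faces_eqI[of t \<sigma> "a i" "a (Suc i)" z]) auto
      then show False
        using t by blast
    qed
    then show ?thesis
      using t z by (auto simp: R_def)
  qed
  then have R: "R (a i) (a (Suc i)) (SOME p. R (a i) (a (Suc i)) p)" for i
    by (rule someI_ex)
  \<comment> \<open>The choice depends only on the pair of vertices \<open>a i\<close>,
    \<open>a (Suc i)\<close>, so \<open>b\<close> inherits the period of \<open>a\<close>.\<close>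
  define b where "b = (\<lambda>i. fst (SOME p. R (a i) (a (Suc i)) p))"
  define T where "T = (\<lambda>i. snd (SOME p. R (a i) (a (Suc i)) p))"
  have T: "T i \<in> F" "T i \<noteq> \<sigma>" "b i \<notin> range a" 
     "bd (T i) = {{a i, a (Suc i)}, {a i, b i}, {a (Suc i), b i}}" for i
    using R[of i] by (auto simp: R_def b_def T_def split: prod.splits)
  have a_Suc_mod: "a (Suc (i mod n)) = a (Suc i)" for i
    by (metis a_mod mod_Suc_eq)
  have b_mod: "b (i mod n) = b i" for i
    by (simp add: b_def a_mod a_Suc_mod)
  have ab: "a i \<noteq> b j" "b j \<noteq> a i" for i j
    using T(3)[of j] by (metis rangeI)+
  have T_ne: "T i \<noteq> T (Suc i)" for i
  proof
    assume "T i = T (Suc i)"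
    then have "{a i, a (Suc i)} \<in> {{a (Suc i), a (Suc (Suc i))}, {a (Suc i), b (Suc i)}, {a (Suc (Suc i)), b (Suc i)}}"
      using T(4)[of i] T(4)[of "Suc i"] by auto
    then show False
      using a2[of i] a1[of i] ab by (auto simp: doubleton_eq_iff)
  qed
  \<comment> \<open>The fan at \<open>a (Suc i)\<close> is \<open>T i\<close>,
    \<open>\<sigma>\<close>, \<open>T (Suc i)\<close>; the fourth face will be
    \<open>U i\<close>.\<close>
  have at_a: "{a (Suc i), b i} \<noteq> {a (Suc i), b (Suc i)}"
    "{e \<in> G. a (Suc i) \<in> e} = {{a (Suc i), b i}, {a i, a (Suc i)}, {a (Suc i), a (Suc (Suc i))}, {a (Suc i), b (Suc i)}}"
    "\<exists>k\<in>F. k \<noteq> T i \<and> k \<noteq> \<sigma> \<and> k \<noteq> T (Suc i) \<and> {a (Suc i), b i} \<in> bd k \<and> {a (Suc i), b (Suc i)} \<in> bd k" for i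
  proof -
    have mem: "{a (Suc i), b i} \<in> bd (T i)" "{a i, a (Suc i)} \<in> bd (T i)"
        "{a (Suc i), a (Suc (Suc i))} \<in> bd (T (Suc i))" "{a (Suc i), b (Suc i)} \<in> bd (T (Suc i))"
      unfolding T(4) by blast+
    have ne: "{a (Suc i), b i} \<noteq> {a i, a (Suc i)}"
        "{a i, a (Suc i)} \<noteq> {a (Suc i), a (Suc (Suc i))}"
        "{a (Suc i), a (Suc (Suc i))} \<noteq> {a (Suc i), b (Suc i)}"
      using ab a2[of i] a1 by (auto simp: doubleton_eq_iff)
    note * = fourth_face[OF T(1) \<sigma> T(1) T(2) T(2)[symmetric] T_ne
          mem(1,2) a_edge a_edge mem(3,4) insertI1 insertI2[OF insertI1] insertI1 insertI1 ne]
    show "{a (Suc i), b i} \<noteq> {a (Suc i), b (Suc i)}"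
      "{e \<in> G. a (Suc i) \<in> e} = {{a (Suc i), b i}, {a i, a (Suc i)}, {a (Suc i), a (Suc (Suc i))}, {a (Suc i), b (Suc i)}}"
      "\<exists>k\<in>F. k \<noteq> T i \<and> k \<noteq> \<sigma> \<and> k \<noteq> T (Suc i) \<and> {a (Suc i), b i} \<in> bd k \<and> {a (Suc i), b (Suc i)} \<in> bd k"
      by (fact *)+
  qed
  have b1: "b i \<noteq> b (Suc i)" for i
    using at_a(1)[of i] by auto
  have "\<exists>U\<in>F. U \<noteq> T i \<and> U \<noteq> \<sigma> \<and> U \<noteq> T (Suc i) \<and>
      bd U = {{a (Suc i), b i}, {a (Suc i), b (Suc i)}, {b i, b (Suc i)}}" for i
  proof -
    obtain k where k: "k \<in> F" "k \<noteq> T i" "k \<noteq> \<sigma>" "k \<noteq> T (Suc i)"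
        "{a (Suc i), b i} \<in> bd k" "{a (Suc i), b (Suc i)} \<in> bd k"
      using at_a(3)[of i] by blast
    \<comment> \<open>The face \<open>k\<close> contains \<open>a (Suc i)\<close>, hence touches
      \<open>\<sigma>\<close>.\<close>
    have "card (bd k) = 3"
      using tri[OF k(1,3,5) insertI1] .
    then show ?thesis
      using triangle_bd[OF k(1) _ k(5,6) b1] k by blast
  qed
  then obtain U where U: "\<And>i. U i \<in> F" "\<And>i. U i \<noteq> T i" "\<And>i. U i \<noteq> \<sigma>" "\<And>i. U i \<noteq> T (Suc i)"
      "\<And>i. bd (U i) = {{a (Suc i), b i}, {a (Suc i), b (Suc i)}, {b i, b (Suc i)}}"
    by metis
  have U_ne: "U i \<noteq> U (Suc i)" for i
  proof
    assume "U i = U (Suc i)"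
    then have "{a (Suc i), b i} \<in> {{a (Suc (Suc i)), b (Suc i)}, {a (Suc (Suc i)), b (Suc (Suc i))}, {b (Suc i), b (Suc (Suc i))}}"
      using U(5)[of i] U(5)[of "Suc i"] by auto
    then show False
      using a1[of "Suc i"] ab by (auto simp: doubleton_eq_iff)
  qed
  \<comment> \<open>The fan at \<open>b (Suc i)\<close> is \<open>U i\<close>,
    \<open>T (Suc i)\<close>, \<open>U (Suc i)\<close>. Nothing is known about the degree of the
    fourth face, since it need not touch \<open>\<sigma>\<close>.\<close>
  have at_b: "{b i, b (Suc i)} \<noteq> {b (Suc i), b (Suc (Suc i))}"
    "{e \<in> G. b (Suc i) \<in> e} = {{b i, b (Suc i)}, {a (Suc i), b (Suc i)}, {a (Suc (Suc i)), b (Suc i)}, {b (Suc i), b (Suc (Suc i))}}"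
    "\<exists>k\<in>F. k \<noteq> U i \<and> k \<noteq> T (Suc i) \<and> k \<noteq> U (Suc i) \<and> {b i, b (Suc i)} \<in> bd k \<and> {b (Suc i), b (Suc (Suc i))} \<in> bd k" for i
  proof -
    have mem: "{b i, b (Suc i)} \<in> bd (U i)" "{a (Suc i), b (Suc i)} \<in> bd (U i)"
        "{a (Suc i), b (Suc i)} \<in> bd (T (Suc i))" "{a (Suc (Suc i)), b (Suc i)} \<in> bd (T (Suc i))"
        "{a (Suc (Suc i)), b (Suc i)} \<in> bd (U (Suc i))" "{b (Suc i), b (Suc (Suc i))} \<in> bd (U (Suc i))"
      unfolding T(4) U(5) by blast+
    have ne: "{b i, b (Suc i)} \<noteq> {a (Suc i), b (Suc i)}"
        "{a (Suc i), b (Suc i)} \<noteq> {a (Suc (Suc i)), b (Suc i)}"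
        "{a (Suc (Suc i)), b (Suc i)} \<noteq> {b (Suc i), b (Suc (Suc i))}"
      using ab a1[of "Suc i"] by (auto simp: doubleton_eq_iff)
    have in2: "b (Suc i) \<in> {y, b (Suc i)}" for y
      by simp
    note * = fourth_face[OF U(1) T(1) U(1) U(4) U(2)[symmetric] U_ne mem in2 in2 in2 insertI1 ne]
    show "{b i, b (Suc i)} \<noteq> {b (Suc i), b (Suc (Suc i))}"
      "{e \<in> G. b (Suc i) \<in> e} = {{b i, b (Suc i)}, {a (Suc i), b (Suc i)}, {a (Suc (Suc i)), b (Suc i)}, {b (Suc i), b (Suc (Suc i))}}"
      "\<exists>k\<in>F. k \<noteq> U i \<and> k \<noteq> T (Suc i) \<and> k \<noteq> U (Suc i) \<and> {b i, b (Suc i)} \<in> bd k \<and> {b (Suc i), b (Suc (Suc i))} \<in> bd k"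
      by (fact *)+
  qed
  have "\<exists>k\<in>F. k \<noteq> U i \<and> k \<noteq> U (Suc i) \<and> {b i, b (Suc i)} \<in> bd k \<and>
      {b (Suc i), b (Suc (Suc i))} \<in> bd k" for i
    using at_b(3)[of i] by blast
  then obtain K where K: "\<And>i. K i \<in> F" "\<And>i. K i \<noteq> U i" "\<And>i. K i \<noteq> U (Suc i)"
      "\<And>i. {b i, b (Suc i)} \<in> bd (K i)" "\<And>i. {b (Suc i), b (Suc (Suc i))} \<in> bd (K i)"
    by metis
  have b2: "b i \<noteq> b (Suc (Suc i))" for i
    using at_b(1)[of i] by (auto simp: insert_commute)
  \<comment> \<open>Both faces contain the edge from \<open>b (Suc i)\<close> to
    \<open>b (Suc (Suc i))\<close>, and neither is \<open>U (Suc i)\<close>, the other face on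
    it.\<close>
  have "K (Suc i) = K i" for i
    using face_cases[of "U (Suc i)" "K i" "{b (Suc i), b (Suc (Suc i))}" "K (Suc i)"] U K[of i] K[of "Suc i"]
    by auto
  then have K0: "K i = K 0" for i
    by (induction i) auto
  define W where "W = K 0"
  have W: "W \<in> F" "W \<noteq> U i" "{b i, b (Suc i)} \<in> bd W" for i
    using K[of i] K0[of i] by (auto simp: W_def)
  have b_period: "b (i + n) = b i" for i
    by (metis b_mod mod_add_self2)
  have b_pred: "\<exists>j. b i = b (Suc j)" for i
    using b_period[of i] m by (metis add_Suc_right)
  \<comment> \<open>The edges at the \<open>a\<close> and \<open>b\<close> vertices are known at
    successor indices only. Going once around, by \<open>n - 1\<close> steps, shifts
    \<open>a\<close> and \<open>b\<close> simultaneously.\<close>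
  have ab_pred: "\<exists>j. a i = a (Suc j) \<and> b i = b (Suc j) \<and> a (Suc i) = a (Suc (Suc j))" for i
    using a_period[of i] b_period[of i] a_period[of "Suc i"] m by (metis add_Suc_right add_Suc)
  have bd_W: "bd W = range (\<lambda>i. {b i, b (Suc i)})"
    using bd_cycle[OF W(1) W(3) b2 b_pred] .
  then have verts_W: "\<Union>(bd W) = range b"
    using b_pred by auto
  \<comment> \<open>A priori the triangles over distant edges of \<open>\<sigma>\<close> could share
    an apex. But by \<open>at_b\<close> only two of the four edges at an apex lead to vertices of
    \<open>\<sigma>\<close>, so the apex determines the edge of \<open>\<sigma>\<close> below
    it.\<close>
  have b_eq: "i mod n = j mod n" if "b i = b j" for i j
  proof -
    obtain k l where kl: "b i = b (Suc k)" "a i = a (Suc k)" "a (Suc i) = a (Suc (Suc k))"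
        "b j = b (Suc l)" "a j = a (Suc l)" "a (Suc j) = a (Suc (Suc l))"
      using ab_pred by metis
    have "{{a (Suc l), b (Suc l)}, {a (Suc (Suc l)), b (Suc l)}} \<subseteq> {e \<in> G. b (Suc k) \<in> e}"
      using T(4)[of "Suc l"] bd_sub[OF T(1)[of "Suc l"]] that kl by auto
    then have "a (Suc l) \<in> {a (Suc k), a (Suc (Suc k))}" "a (Suc (Suc l)) \<in> {a (Suc k), a (Suc (Suc k))}"
      unfolding at_b(2)[of k]
      using ab by (auto simp: doubleton_eq_iff)
    then have "a i = a j \<or> a j = a (Suc i) \<and> a (Suc j) = a i"
      using a1[of "Suc l"] kl by auto
    \<comment> \<open>The same edge traversed backwards: periodicity would give
      \<open>a (Suc (Suc i)) = a i\<close>.\<close>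
    moreover have False if "a j = a (Suc i)" "a (Suc j) = a i"
    proof -
      have "a (Suc j) = a (Suc (Suc i))"
        using a_eq[OF that(1)] a_mod by (metis mod_Suc_eq)
      then show False
        using that a2[of i] by simp
    qed
    ultimately show ?thesis
      using a_eq by blast
  qed
  have inj_b: "inj_on b {..<n}"
    by (rule inj_onI) (use b_eq in fastforce)
  have npos: "n > 0"
    using n by simp
  have range_a: "a ` {..<n} = range a"
    using a_mod npos by (auto simp: image_iff) (metis lessThan_iff mod_less_divisor)
  have range_b: "b ` {..<n} = range b"
    using b_mod npos by (auto simp: image_iff) (metis lessThan_iff mod_less_divisor)
  have a_in: "a i \<in> V" for i
    using edgeD(3)[OF \<sigma> a_edge] .
  have b_in: "b i \<in> V" for i
    using edgeD(3)[OF W(1) W(3)] .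
  define L where "L = range (\<lambda>i. {a i, a (Suc i)}) \<union> range (\<lambda>i. {b i, b (Suc i)}) \<union>
      range (\<lambda>i. {a i, b i}) \<union> range (\<lambda>i. {a (Suc i), b i})"
  have incident: "e \<in> L" if "e \<in> G" "x \<in> e" "x \<in> range a \<union> range b" for e x
  proof -
    from that(3) obtain i where "x = a (Suc i) \<or> x = b (Suc i)"
      using a_pred b_pred by blast
    then have "e \<in> {e \<in> G. a (Suc i) \<in> e} \<or> e \<in> {e \<in> G. b (Suc i) \<in> e}"
      using that by blast
    then show ?thesis
      unfolding at_a(2) at_b(2) L_def by (elim disjE) auto
  qed
  have L_sub: "e \<subseteq> range a \<union> range b" if "e \<in> L" for e
    using that by (auto simp: L_def)
  \<comment> \<open>All neighbours of the \<open>a\<close> and \<open>b\<close> vertices are again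
    such vertices, so connectedness leaves no others.\<close>
  have V_eq: "V = range a \<union> range b"
  proof
    show "V \<subseteq> range a \<union> range b"
    proof
      fix y assume "y \<in> V"
      then have "(a 0, y) \<in> {(x, y). {x, y} \<in> G}\<^sup>*"
        using graph_connected a_in by blast
      then show "y \<in> range a \<union> range b"
      proof induction
        case (step y z)
        then have "{y, z} \<in> L"
          using incident[of "{y, z}" y] by blast
        then show ?case
          using L_sub by blast
      qed blast
    qed
  qed (use a_in b_in in blast)
  have G_eq: "G = L"
  proof
    show "G \<subseteq> L"
    proof
      fix e assume e: "e \<in> G"
      then obtain x where "x \<in> e"
        using edge_card[OF e] by (auto simp: card_2_iff)
      then show "e \<in> L"
        using incident e edge_sub[OF e] V_eq by blast
    qed
    have "{a i, b i} \<in> G" "{a (Suc i), b i} \<in> G" for i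
      using T(4)[of i] bd_sub[OF T(1)[of i]] by auto
    then show "L \<subseteq> G"
      using a_edge W bd_sub \<sigma> unfolding L_def by blast
  qed
  \<comment> \<open>Every edge in \<open>L\<close> already has two known faces, and every face has
    an edge.\<close>
  have F_eq: "F = {\<sigma>, W} \<union> range T \<union> range U"
  proof
    show "F \<subseteq> {\<sigma>, W} \<union> range T \<union> range U"
    proof
      fix f assume f: "f \<in> F"
      then obtain e where e: "e \<in> bd f"
        using bd_nonempty by blast
      then have "e \<in> L"
        using G_eq f bd_sub by blast
      then consider i where "e = {a i, a (Suc i)}" | i where "e = {b i, b (Suc i)}"
        | i where "e = {a i, b i}" | i where "e = {a (Suc i), b i}"
        unfolding L_def by blast
      then show "f \<in> {\<sigma>, W} \<union> range T \<union> range U"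
      proof cases
        case (1 i)
        then show ?thesis
          using face_cases[of \<sigma> "T i" e f] \<sigma> T[of i] a_edge f e by auto
      next
        case (2 i)
        then show ?thesis
          using face_cases[of W "U i" e f] W U f e by auto
      next
        case (3 i)
        \<comment> \<open>The edge from \<open>a i\<close> to \<open>b i\<close> separates
          \<open>T i\<close> from the preceding \<open>U\<close>, whence the shift to a successor
          index.\<close>
        then obtain j where "e = {a (Suc j), b (Suc j)}"
          using ab_pred by metis
        then show ?thesis
          using face_cases[of "T (Suc j)" "U j" e f] T[of "Suc j"] U(1,4,5)[of j] f e by auto
      next
        case (4 i)
        then show ?thesis
          using face_cases[of "T i" "U i" e f] T[of i] U(1,2,5)[of i] f e by auto
      qed
    qed
  qed (use \<sigma> W T U in auto)
  have UN_period: "range g = g ` {..<n}" if "\<And>i. g (i mod n) = g i" for g :: "nat \<Rightarrow> 'v set"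
    using that npos by (auto simp: image_iff) (metis lessThan_iff mod_less_divisor)
  have b_Suc_mod: "b (Suc (i mod n)) = b (Suc i)" for i
    by (metis b_mod mod_Suc_eq)
  show thesis
  proof (rule that[of n a b, OF n inj_a inj_b])
    show "a ` {..<n} \<inter> b ` {..<n} = {}"
      using ab by auto
    show "V = a ` {..<n} \<union> b ` {..<n}"
      using V_eq range_a range_b by simp
    show "G = (\<Union>i<n. {{a i, a (Suc i mod n)}, {b i, b (Suc i mod n)}, {a i, b i}, {a (Suc i mod n), b i}})"
      unfolding G_eq L_def
      by (subst (1 2 3 4) UN_period) (auto simp: a_mod b_mod a_Suc_mod b_Suc_mod)
    have "(\<lambda>f. \<Union>(bd f)) ` F = {range a, range b} \<union> range (\<lambda>i. {a i, a (Suc i), b i})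
        \<union> range (\<lambda>i. {a (Suc i), b i, b (Suc i)})"
    proof -
      have "\<Union>(bd (T i)) = {a i, a (Suc i), b i}" "\<Union>(bd (U i)) = {a (Suc i), b i, b (Suc i)}" for i
        unfolding T(4) U(5) by auto
      then show ?thesis
        unfolding F_eq image_Un image_image image_insert image_empty verts_\<sigma> verts_W by simp
    qed
    also have "\<dots> = {a ` {..<n}, b ` {..<n}} \<union>
       (\<Union>i<n. {{a i, a (Suc i mod n), b i}, {a (Suc i mod n), b i, b (Suc i mod n)}})"
      unfolding range_a range_b
      by (subst (1 2) UN_period) (auto simp: a_mod b_mod a_Suc_mod b_Suc_mod)
    finally show "(\<lambda>f. \<Union>(bd f)) ` F = {a ` {..<n}, b ` {..<n}} \<union>
       (\<Union>i<n. {{a i, a (Suc i mod n), b i}, {a (Suc i mod n), b i, b (Suc i mod n)}})" .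
  qed
qed

end

section \<open>Closed disks in surfaces\<close>

text \<open>One notion for sphere and plane. The charts go onto the fixed space
  \<open>real^2\<close>, although the ambient type may have dimension 2 or 3, so that invariance of
  domain can be applied inside \<open>real^2\<close>.\<close>

definition two_manifold :: "'a::euclidean_space set \<Rightarrow> bool" where
  "two_manifold S \<longleftrightarrow>
     (\<forall>z\<in>S. \<exists>N. openin (top_of_set S) N \<and> z \<in> N \<and> N homeomorphic (UNIV :: (real^2) set))"

text \<open>Around \<open>z\<close> on the sphere the chart is the complement of the antipode
  \<open>- z\<close>; the plane is its own chart.\<close>

lemma two_manifold_sphere_or_plane:
  fixes S :: "'a::euclidean_space set"
  assumes "is_two_sphere S \<or> is_plane S"
  shows "two_manifold S"
  unfolding two_manifold_def
proof
  fix z assume z: "z \<in> S"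
  show "\<exists>N. openin (top_of_set S) N \<and> z \<in> N \<and> N homeomorphic (UNIV :: (real^2) set)"
    using assms
  proof
    assume "is_two_sphere S"
    then have S: "DIM('a) = 3" "S = sphere 0 1"
      by (auto simp: is_two_sphere_def)
    have "z \<noteq> - z"
    proof
      assume "z = - z"
      then have "2 *\<^sub>R z = 0"
        by (metis scaleR_2 right_minus)
      then show False
        using z S(2) by simp
    qed
    moreover have "- z \<in> sphere 0 1"
      using z S(2) by simp
    moreover have "S - {- z} homeomorphic (UNIV :: (real^2) set)"
      unfolding S(2)
      by (rule homeomorphic_punctured_sphere_affine) (use calculation S in auto)
    moreover have "openin (top_of_set S) (S - {- z})"
      by (rule openin_delete) simp
    ultimately show ?thesis
      using z by (intro exI[of _ "S - {- z}"]) auto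
  next
    assume "is_plane S"
    then have S: "DIM('a) = 2" "S = UNIV"
      by (auto simp: is_plane_def)
    then have "S homeomorphic (UNIV :: (real^2) set)"
      by (simp add: homeomorphic_affine_sets_eq)
    then show ?thesis
      using z by (intro exI[of _ S]) auto
  qed
qed

text \<open>Invariance of domain, read in a chart of the target. It makes the image of an open disk
  open in the surface.\<close>

lemma open_map_into_two_manifold:
  fixes h :: "real^2 \<Rightarrow> 'a::euclidean_space"
  assumes S: "two_manifold S" and W: "open W" "continuous_on W h" "inj_on h W" "h ` W \<subseteq> S"
  shows "openin (top_of_set S) (h ` W)"
proof (subst openin_subopen, rule ballI)
  fix y assume y: "y \<in> h ` W"
  then obtain N p q where N: "openin (top_of_set S) N" "y \<in> N"
      and pq: "homeomorphism N (UNIV :: (real^2) set) p q"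
    using S W(4) unfolding two_manifold_def homeomorphic_def by blast
  obtain X where X: "open X" "N = S \<inter> X"
    using N(1) by (auto simp: openin_open)
  define W' where "W' = W \<inter> h -` X"
  have W': "open W'" "W' \<subseteq> W" "h ` W' \<subseteq> N"
    using continuous_open_preimage[OF W(2,1) X(1)] W(4) X(2) by (auto simp: W'_def)
  have "open ((p \<circ> h) ` W')"
  proof (rule invariance_of_domain)
    show "continuous_on W' (p \<circ> h)"
      using W' W(2) pq
      by (intro continuous_on_compose) (auto simp: homeomorphism_def intro: continuous_on_subset)
    show "inj_on (p \<circ> h) W'"
      using W' W(3) pq
      by (intro comp_inj_on inj_on_inverseI[of "h ` W'" q]) (auto simp: homeomorphism_def intro: inj_on_subset)
  qed (rule W'(1))
  then have "openin (top_of_set N) (q ` (p \<circ> h) ` W')"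
    using homeomorphism_imp_open_map[OF homeomorphism_symD[OF pq]] by simp
  moreover have "q ` (p \<circ> h) ` W' = h ` W'"
  proof -
    have "q (p (h w)) = h w" if "w \<in> W'" for w
      using W'(3) that pq by (auto simp: homeomorphism_def)
    then show ?thesis
      by (simp add: image_image)
  qed
  ultimately have "openin (top_of_set S) (h ` W')"
    using N(1) openin_trans by fastforce
  moreover have "y \<in> h ` W'"
    using y N(2) X(2) by (auto simp: W'_def)
  ultimately show "\<exists>T. openin (top_of_set S) T \<and> y \<in> T \<and> T \<subseteq> h ` W"
    using W'(2) by blast
qed

text \<open>The companion with the chart in the source. It bounds the interior of a closed disk from
  above.\<close>

lemma open_map_from_two_manifold:
  fixes k :: "'a::euclidean_space \<Rightarrow> real^2"
  assumes S: "two_manifold S" and U: "openin (top_of_set S) U" "continuous_on U k" "inj_on k U"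
  shows "open (k ` U)"
proof (subst open_subopen, rule ballI)
  fix y assume y: "y \<in> k ` U"
  then obtain x where x: "x \<in> U" "y = k x"
    by blast
  then have "x \<in> S"
    using openin_imp_subset[OF U(1)] by blast
  then obtain N p q where N: "openin (top_of_set S) N" "x \<in> N"
      and pq: "homeomorphism N (UNIV :: (real^2) set) p q"
    using S unfolding two_manifold_def homeomorphic_def by blast
  have NS: "N \<subseteq> S"
    using N(1) openin_imp_subset by blast
  have "openin (top_of_set N) (N \<inter> U)"
    using U(1) NS by (auto simp: openin_open)
  then have op: "open (p ` (N \<inter> U))"
    using homeomorphism_imp_open_map[OF pq] by fastforce
  have qp: "q ` p ` (N \<inter> U) = N \<inter> U"
    using pq by (force simp: homeomorphism_def image_image)
  have "open ((k \<circ> q) ` p ` (N \<inter> U))"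
  proof (rule invariance_of_domain[OF _ op])
    show "continuous_on (p ` (N \<inter> U)) (k \<circ> q)"
      using U(2) pq qp
      by (intro continuous_on_compose) (auto simp: homeomorphism_def intro: continuous_on_subset)
    have "inj q"
      using pq by (auto simp: homeomorphism_def intro: inj_on_inverseI[of _ p])
    then show "inj_on (k \<circ> q) (p ` (N \<inter> U))"
      using U(3) qp by (intro comp_inj_on) (auto intro: inj_on_subset)
  qed
  moreover have "(k \<circ> q) ` p ` (N \<inter> U) = k ` (N \<inter> U)"
    using qp by (metis image_comp)
  ultimately show "\<exists>T. open T \<and> y \<in> T \<and> T \<subseteq> k ` U"
    using x N(2) by auto
qed

text \<open>However the disk is placed in the surface, its frontier there is the image of the unit
  circle. This turns the frontier in \<open>face_boundary\<close> into a topological circle.\<close>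

lemma closed_disk_in_two_manifold:
  fixes h :: "real^2 \<Rightarrow> 'a::euclidean_space"
  assumes S: "two_manifold S" and D: "D \<subseteq> S" and hk: "homeomorphism (cball 0 1) D h k"
  shows "openin (top_of_set S) (h ` ball 0 1)" "top_of_set S frontier_of D = h ` sphere 0 1"
proof -
  have h: "continuous_on (cball 0 1) h" "h ` cball 0 1 = D" "inj_on h (cball 0 1)"
    and k: "continuous_on D k" "k ` D = cball 0 1" "inj_on k D"
    using hk by (auto simp: homeomorphism_def intro: inj_on_inverseI[of _ k] inj_on_inverseI[of _ h])
  have balls: "ball (0::real^2) 1 \<subseteq> cball 0 1"
    by auto
  show op: "openin (top_of_set S) (h ` ball 0 1)"
    using S h D balls
    by (intro open_map_into_two_manifold) (auto intro: continuous_on_subset inj_on_subset)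
  have "closed D"
    using h compact_continuous_image compact_cball compact_imp_closed by metis
  then have "closedin (top_of_set S) D"
    using D closed_subset by blast
  moreover have "top_of_set S interior_of D = h ` ball 0 1"
  proof
    show "h ` ball 0 1 \<subseteq> top_of_set S interior_of D"
      using op h(2) by (intro interior_of_maximal) auto
    \<comment> \<open>No rim point is interior: \<open>k\<close> carries the interior of
      \<open>D\<close> to an open subset of the closed ball, hence into the open ball.\<close>
    let ?I = "top_of_set S interior_of D"
    have I: "openin (top_of_set S) ?I" "?I \<subseteq> D"
      by (auto simp: interior_of_subset)
    then have "open (k ` ?I)"
      using S k by (intro open_map_from_two_manifold[of S]) (auto intro: continuous_on_subset inj_on_subset)
    moreover have "k ` ?I \<subseteq> cball 0 1"
      using I k by blast
    ultimately have "k ` ?I \<subseteq> ball 0 1"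
      using interior_maximal[of "k ` ?I" "cball 0 1"] by simp
    moreover have "h (k y) = y" if "y \<in> ?I" for y
      using that I hk by (auto simp: homeomorphism_def)
    ultimately show "?I \<subseteq> h ` ball 0 1"
      by (metis image_eqI image_subset_iff subsetI)
  qed
  ultimately have "top_of_set S frontier_of D = h ` cball 0 1 - h ` ball 0 1"
    by (simp add: frontier_of_def closure_of_closedin h(2))
  also have "\<dots> = h ` (cball 0 1 - ball 0 1)"
    using inj_on_image_set_diff[OF h(3) _ balls] by simp
  also have "cball 0 1 - ball 0 1 = (sphere 0 1 :: (real^2) set)"
    by auto
  finally show "top_of_set S frontier_of D = h ` sphere 0 1" .
qed

section \<open>Arcs and intervals\<close>

lemma no_open_set_in_arc:
  fixes h :: "real^2 \<Rightarrow> 'a::t2_space"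
  assumes "arc g" "open W" "continuous_on W h" "inj_on h W" "h ` W \<subseteq> path_image g"
  shows "W = {}"
proof (rule ccontr)
  assume "W \<noteq> {}"
  obtain k where k: "homeomorphism {0..1} (path_image g) g k"
    using homeomorphism_arc[OF assms(1)] .
  have "dim (UNIV :: (real^2) set) \<le> dim (UNIV :: real set)"
  proof (rule invariance_of_dimension_subspaces)
    show "continuous_on W (k \<circ> h)"
      using assms(3,5) k
      by (intro continuous_on_compose) (auto simp: homeomorphism_def intro: continuous_on_subset)
    show "inj_on (k \<circ> h) W"
      using assms(4,5) k
      by (intro comp_inj_on inj_on_inverseI[of "h ` W" g]) (auto simp: homeomorphism_def)
    show "openin (top_of_set UNIV) W"
      using assms(2) by simp
  qed (use \<open>W \<noteq> {}\<close> in auto)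
  then show False
    by simp
qed

lemma connected_arc_minus_endpoint:
  fixes g :: "real \<Rightarrow> 'a::t2_space"
  assumes "arc g" "x \<in> {pathstart g, pathfinish g}"
  shows "connected (path_image g - {x})"
proof -
  have inj: "inj_on g {0..1}" and cont: "continuous_on {0..1} g"
    using assms(1) by (auto simp: arc_def path_def)
  obtain t where t: "t \<in> {0, 1}" "x = g t"
    using assms(2) by (auto simp: pathstart_def pathfinish_def)
  have "path_image g - {x} = g ` ({0..1} - {t})"
    using inj_on_image_set_diff[OF inj, of "{0..1}" "{t}"] t(1) unfolding t(2) path_image_def by fastforce
  moreover have "{0..1} - {t} = (if t = 0 then {0<..1} else {0..<1})"
    using t(1) by auto
  ultimately show ?thesis
    using cont by (auto intro!: connected_continuous_image intro: continuous_on_subset)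
qed

lemma infinite_arc_image:
  fixes g :: "real \<Rightarrow> 'a::t2_space"
  assumes "arc g"
  shows "infinite (path_image g)"
  using assms finite_imageD[of g "{0..1}"] infinite_Icc[of "0::real" 1]
  by (auto simp: arc_def path_image_def)

text \<open>A point whose removal does not disconnect an interval is an end of it. This carries the
  ends of an arc over to a chart on the line.\<close>

lemma connected_real_one_sided:
  fixes I :: "real set"
  assumes "connected I" "t \<in> I" "connected (I - {t})" "I \<noteq> {t}"
  shows "(\<exists>d>t. {t..d} \<subseteq> I \<and> I \<subseteq> {t..}) \<or> (\<exists>d<t. {d..t} \<subseteq> I \<and> I \<subseteq> {..t})"
proof -
  obtain d where d: "d \<in> I" "d \<noteq> t"
    using assms(2,4) by blast
  have between: False if "u \<in> I" "v \<in> I" "u < t" "t < v" for u v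
    using connectedD_interval[OF assms(3), of u v t] that by auto
  show ?thesis
  proof (cases "d > t")
    case True
    then have "I \<subseteq> {t..}"
      using between[of _ d] d by force
    moreover have "{t..d} \<subseteq> I"
      using connected_contains_Icc[OF assms(1,2) d(1)] .
    ultimately show ?thesis
      using True by blast
  next
    case False
    then have "I \<subseteq> {..t}"
      using between[of d] d by force
    moreover have "{d..t} \<subseteq> I"
      using connected_contains_Icc[OF assms(1) d(1) assms(2)] .
    ultimately show ?thesis
      using False d(2) by (metis linorder_neqE)
  qed
qed

section \<open>Circles composed of arcs\<close>

text \<open>Models the boundary of a closed face. At least three arcs are required so that the
  circle can be punctured away from any two of them, which places both in a line.\<close>

locale circle_of_arcs =
  fixes Z V :: "'a::euclidean_space set" and B :: "'a set set"
  assumes circle: "Z homeomorphic (sphere 0 1 :: (real^2) set)"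
    and finite_arcs: "finite B"
    and circle_eq: "Z = \<Union>B"
    and card_arcs: "3 \<le> card B"
    and arcs: "e \<in> B \<Longrightarrow> \<exists>g. arc g \<and> path_image g = e \<and> e \<inter> V = {pathstart g, pathfinish g}"
    and arcs_meet: "e \<in> B \<Longrightarrow> e' \<in> B \<Longrightarrow> e \<noteq> e' \<Longrightarrow> e \<inter> e' \<subseteq> V"
begin

lemma arc_facts:
  assumes "e \<in> B"
  shows "connected e" "closed e" "infinite e" "finite (e \<inter> V)"
    "x \<in> e \<Longrightarrow> x islimpt e" "x \<in> e \<Longrightarrow> x \<in> V \<Longrightarrow> connected (e - {x})"
proof -
  obtain g where g: "arc g" "path_image g = e" "e \<inter> V = {pathstart g, pathfinish g}"
    using arcs assms by blast
  show "connected e" "closed e" "infinite e" "finite (e \<inter> V)"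
    using g connected_arc_image closed_arc_image infinite_arc_image by auto
  then show "x islimpt e" if "x \<in> e"
    using that by (intro connected_imp_perfect) auto
  show "connected (e - {x})" if "x \<in> e" "x \<in> V"
    using connected_arc_minus_endpoint[OF g(1), of x] g that by auto
qed

text \<open>A third arc is infinite but has finitely many points in \<open>V\<close>; any other of
  its points avoids the two given arcs.\<close>

lemma point_off_two_arcs:
  assumes "e \<in> B" "e' \<in> B"
  obtains p where "p \<in> Z" "p \<notin> e" "p \<notin> e'"
proof -
  have "\<not> B \<subseteq> {e, e'}"
  proof
    assume "B \<subseteq> {e, e'}"
    then have "card B \<le> card {e, e'}"
      by (intro card_mono) auto
    also have "\<dots> \<le> 2"
      by (simp add: card_insert_if)
    finally show False
      using card_arcs by simp
  qed
  then obtain c where c: "c \<in> B" "c \<noteq> e" "c \<noteq> e'"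
    by blast
  then obtain p where "p \<in> c" "p \<notin> V"
    using arc_facts(3,4)[OF c(1)] by (metis Int_absorb2 subsetI)
  then show thesis
    using that[of p] c arcs_meet assms circle_eq by blast
qed

lemma punctured_circle_chart:
  assumes "p \<in> Z"
  shows "(Z - {p}) homeomorphic (UNIV :: real set)"
proof -
  obtain h k where hk: "homeomorphism Z (sphere 0 1 :: (real^2) set) h k"
    using circle unfolding homeomorphic_def by blast
  have "inj_on h Z" "h ` Z = sphere 0 1"
    using hk by (auto simp: homeomorphism_def intro: inj_on_inverseI[of _ k])
  then have "h ` (Z - {p}) = sphere 0 1 - {h p}" "h p \<in> sphere 0 1"
    using inj_on_image_set_diff[of h Z Z "{p}"] assms by auto
  then have "Z - {p} homeomorphic (sphere 0 1 - {h p} :: (real^2) set)"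
    using homeomorphism_of_subsets[OF hk, of "Z - {p}"] unfolding homeomorphic_def by blast
  also have "\<dots> homeomorphic (UNIV :: real set)"
    by (rule homeomorphic_punctured_sphere_affine) (use \<open>h p \<in> sphere 0 1\<close> in auto)
  finally show ?thesis .
qed

lemma arc_one_sided:
  assumes hom: "homeomorphism (Z - {p}) (UNIV :: real set) \<phi> \<psi>"
    and e: "e \<in> B" "p \<notin> e" and x: "x \<in> e" "x \<in> V"
  shows "(\<exists>d>\<phi> x. {\<phi> x..d} \<subseteq> \<phi> ` e \<and> \<phi> ` e \<subseteq> {\<phi> x..}) \<or>
    (\<exists>d<\<phi> x. {d..\<phi> x} \<subseteq> \<phi> ` e \<and> \<phi> ` e \<subseteq> {..\<phi> x})"
proof (rule connected_real_one_sided)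
  have sub: "e \<subseteq> Z - {p}"
    using e circle_eq by blast
  have cont: "continuous_on e \<phi>" and inj: "inj_on \<phi> e"
    using hom sub by (auto simp: homeomorphism_def intro: continuous_on_subset inj_on_inverseI[of _ \<psi>])
  show "connected (\<phi> ` e)"
    by (rule connected_continuous_image[OF cont arc_facts(1)[OF e(1)]])
  have "\<phi> ` e - {\<phi> x} = \<phi> ` (e - {x})"
    using inj_on_image_set_diff[OF inj, of e "{x}"] x by auto
  then show "connected (\<phi> ` e - {\<phi> x})"
    using connected_continuous_image[OF continuous_on_subset[OF cont], of "e - {x}"]
      arc_facts(6)[OF e(1) x] by auto
  show "\<phi> ` e \<noteq> {\<phi> x}"
    using arc_facts(3)[OF e(1)] finite_imageD[OF _ inj] by fastforce
qed (use x in auto)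

text \<open>If \<open>e\<close> were alone at \<open>x\<close>, it would contain a neighbourhood of
  \<open>x\<close> in the circle and extend to both sides of \<open>x\<close> in the chart, but
  \<open>x\<close> is an end of \<open>e\<close>.\<close>

lemma second_arc:
  assumes e: "e \<in> B" and x: "x \<in> e" "x \<in> V"
  obtains e' where "e' \<in> B" "e' \<noteq> e" "x \<in> e'"
proof (rule ccontr)
  assume "\<not> thesis"
  then have only: "x \<notin> e'" if "e' \<in> B" "e' \<noteq> e" for e'
    using that \<open>\<And>e'. e' \<in> B \<Longrightarrow> e' \<noteq> e \<Longrightarrow> x \<in> e' \<Longrightarrow> thesis\<close> by blast
  obtain p where p: "p \<in> Z" "p \<notin> e"
    using point_off_two_arcs[OF e e] by blast
  obtain \<phi> \<psi> where hom: "homeomorphism (Z - {p}) (UNIV :: real set) \<phi> \<psi>"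
    using punctured_circle_chart[OF p(1)] unfolding homeomorphic_def by blast
  \<comment> \<open>The union of the other arcs is closed because they are finitely many, so its
    complement is the required neighbourhood.\<close>
  define C where "C = \<Union>(B - {e})"
  have "closed C"
    unfolding C_def using finite_arcs arc_facts(2) by (intro closed_Union) auto
  then have "openin (top_of_set (Z - {p})) (Z - {p} - C)"
    by (metis Diff_eq openin_open open_Compl)
  then have op: "open (\<phi> ` (Z - {p} - C))"
    using homeomorphism_imp_open_map[OF hom] by fastforce
  have "x \<in> Z - {p} - C"
    using x e p only circle_eq by (auto simp: C_def)
  then obtain r where r: "r > 0" "ball (\<phi> x) r \<subseteq> \<phi> ` (Z - {p} - C)"
    using op by (meson image_eqI openE)
  moreover have "Z - {p} - C \<subseteq> e"
    using circle_eq by (auto simp: C_def)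
  ultimately have "ball (\<phi> x) r \<subseteq> \<phi> ` e"
    by blast
  moreover have "\<phi> x - r / 2 \<in> ball (\<phi> x) r" "\<phi> x + r / 2 \<in> ball (\<phi> x) r"
    using r(1) by (auto simp: dist_real_def)
  ultimately have "\<phi> x - r / 2 \<in> \<phi> ` e" "\<phi> x + r / 2 \<in> \<phi> ` e"
    by blast+
  then have "\<not> \<phi> ` e \<subseteq> {\<phi> x..}" "\<not> \<phi> ` e \<subseteq> {..\<phi> x}"
    using r(1) by auto
  then show False
    using arc_one_sided[OF hom e p(2) x] by blast
qed

text \<open>Two arcs ending at \<open>x\<close> leave it on opposite sides and together fill a
  neighbourhood of \<open>x\<close>. A third arc would accumulate at \<open>x\<close> inside their
  union, yet it meets them only in its finitely many points of \<open>V\<close>.\<close>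

lemma no_third_arc:
  assumes e: "e1 \<in> B" "e2 \<in> B" "e3 \<in> B" "e1 \<noteq> e2" "e1 \<noteq> e3" "e2 \<noteq> e3"
    and x: "x \<in> e1" "x \<in> e2" "x \<in> e3"
  shows False
proof -
  have xV: "x \<in> V"
    using arcs_meet[of e1 e2] e x by blast
  obtain p where p: "p \<in> Z" "p \<notin> e1" "p \<notin> e2"
    using point_off_two_arcs[OF e(1,2)] by blast
  obtain \<phi> \<psi> where hom: "homeomorphism (Z - {p}) (UNIV :: real set) \<phi> \<psi>"
    using punctured_circle_chart[OF p(1)] unfolding homeomorphic_def by blast
  have sub: "e1 \<subseteq> Z - {p}" "e2 \<subseteq> Z - {p}"
    using e p circle_eq by auto
  have inj: "inj_on \<phi> (Z - {p})"
    using hom by (auto simp: homeomorphism_def intro: inj_on_inverseI[of _ \<psi>])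
  have "finite (e1 \<inter> e2)"
    using arcs_meet[of e1 e2] e arc_facts(4)[of e1] by (auto intro: finite_subset[of _ "e1 \<inter> V"])
  then have fin: "finite (\<phi> ` e1 \<inter> \<phi> ` e2)"
    by (metis inj_on_image_Int[OF inj sub] finite_imageI)
  have no_common: False if "c < d" "{c..d} \<subseteq> \<phi> ` e1" "{c..d} \<subseteq> \<phi> ` e2" for c d
    using fin that infinite_Icc[OF that(1)] by (meson finite_subset le_inf_iff)
  \<comment> \<open>On the same side the arcs would share an interval, whereas their intersection
    lies in \<open>V\<close> and is finite.\<close>
  have "\<exists>c d. c < \<phi> x \<and> \<phi> x < d \<and> {c..d} \<subseteq> \<phi> ` e1 \<union> \<phi> ` e2"
  proof -
    consider c d where "c < \<phi> x" "\<phi> x < d" "{c..\<phi> x} \<subseteq> \<phi> ` e1 \<union> \<phi> ` e2" "{\<phi> x..d} \<subseteq> \<phi> ` e1 \<union> \<phi> ` e2"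
      | d d' where "\<phi> x < d" "\<phi> x < d'" "{\<phi> x..d} \<subseteq> \<phi> ` e1" "{\<phi> x..d'} \<subseteq> \<phi> ` e2"
      | d d' where "d < \<phi> x" "d' < \<phi> x" "{d..\<phi> x} \<subseteq> \<phi> ` e1" "{d'..\<phi> x} \<subseteq> \<phi> ` e2"
      using arc_one_sided[OF hom e(1) p(2) x(1) xV] arc_one_sided[OF hom e(2) p(3) x(2) xV]
      by (meson le_supI1 le_supI2)
    then show ?thesis
    proof cases
      case (1 c d)
      have "{c..d} \<subseteq> {c..\<phi> x} \<union> {\<phi> x..d}"
        by auto
      then show ?thesis
        using 1 by blast
    next
      case (2 d d')
      then have "{\<phi> x..min d d'} \<subseteq> \<phi> ` e1" "{\<phi> x..min d d'} \<subseteq> \<phi> ` e2" "\<phi> x < min d d'"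
        by (auto simp: subset_iff)
      then show ?thesis
        using no_common by blast
    next
      case (3 d d')
      then have "{max d d'..\<phi> x} \<subseteq> \<phi> ` e1" "{max d d'..\<phi> x} \<subseteq> \<phi> ` e2" "max d d' < \<phi> x"
        by (auto simp: subset_iff)
      then show ?thesis
        using no_common by blast
    qed
  qed
  then obtain c d where cd: "c < \<phi> x" "\<phi> x < d" "{c..d} \<subseteq> \<phi> ` e1 \<union> \<phi> ` e2"
    by blast
  have "openin (top_of_set (Z - {p})) (\<psi> ` {c<..<d})"
    using homeomorphism_imp_open_map[OF homeomorphism_symD[OF hom], of "{c<..<d}"] by simp
  then obtain X where X: "open X" "\<psi> ` {c<..<d} = (Z - {p}) \<inter> X"
    by (auto simp: openin_open)
  have \<psi>: "\<psi> (\<phi> y) = y" if "y \<in> Z - {p}" for y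
    using hom that by (simp add: homeomorphism_def)
  have xZ: "x \<in> Z - {p}"
    using sub x by blast
  then have "x \<in> \<psi> ` {c<..<d}"
    using cd \<psi>[OF xZ] by (metis greaterThanLessThan_iff image_eqI)
  then have "x \<in> X - {p}"
    using X(2) by auto
  \<comment> \<open>The puncture \<open>p\<close> is off \<open>e1\<close> and \<open>e2\<close> but
    may lie on \<open>e3\<close>, so it is removed from the neighbourhood.\<close>
  then have "infinite (e3 \<inter> (X - {p}))"
    using arc_facts(5)[OF e(3) x(3)] X(1) unfolding islimpt_eq_acc_point
    by (metis open_delete inf_commute)
  moreover have "e3 \<inter> (X - {p}) \<subseteq> e3 \<inter> V"
  proof
    fix y assume y: "y \<in> e3 \<inter> (X - {p})"
    then have "y \<in> \<psi> ` {c<..<d}"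
      using X(2) e(3) circle_eq by auto
    then have "y \<in> \<psi> ` {c..d}"
      using greaterThanLessThan_subseteq_atLeastAtMost_iff[of c d c d] by blast
    then have "y \<in> \<psi> ` (\<phi> ` e1 \<union> \<phi> ` e2)"
      using cd(3) by blast
    moreover have "\<psi> ` \<phi> ` e1 = e1" "\<psi> ` \<phi> ` e2 = e2"
      unfolding image_image using \<psi> sub by (simp_all add: subset_iff)
    ultimately have "y \<in> e1 \<union> e2"
      by (simp only: image_Un)
    then show "y \<in> e3 \<inter> V"
      using y arcs_meet[of e1 e3] arcs_meet[of e2 e3] e by blast
  qed
  ultimately show False
    using arc_facts(4)[OF e(3)] finite_subset by blast
qed

lemma card_arcs_at_vertex:
  assumes "x \<in> Z" "x \<in> V"
  shows "card {e \<in> B. x \<in> e} = 2"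
proof -
  obtain e where e: "e \<in> B" "x \<in> e"
    using assms circle_eq by blast
  obtain e' where e': "e' \<in> B" "e' \<noteq> e" "x \<in> e'"
    using second_arc[OF e assms(2)] by blast
  have "{e \<in> B. x \<in> e} = {e, e'}"
    using no_third_arc[of e e' _ x] e e' by blast
  then show ?thesis
    using e'(2) by simp
qed

text \<open>A proper part \<open>A\<close> would split the connected circle into two disjoint
  nonempty closed sets, the unions of \<open>A\<close> and of the remaining arcs.\<close>

lemma connected_circle_of_arcs:
  assumes "A \<subseteq> B" "A \<noteq> {}" "\<And>e e'. e \<in> A \<Longrightarrow> e' \<in> B \<Longrightarrow> e \<inter> e' \<inter> V \<noteq> {} \<Longrightarrow> e' \<in> A"
  shows "A = B"
proof (rule ccontr)
  assume "A \<noteq> B"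
  have "connected (sphere 0 1 :: (real^2) set)"
    by (rule connected_sphere) simp
  then have "connected Z"
    using circle homeomorphic_connectedness by blast
  moreover have "closed (\<Union>A)" "closed (\<Union>(B - A))"
    using assms(1) finite_arcs arc_facts(2) by (auto intro!: closed_Union intro: finite_subset)
  moreover have "Z \<subseteq> \<Union>A \<union> \<Union>(B - A)"
    using circle_eq by blast
  moreover have "\<Union>A \<inter> \<Union>(B - A) \<inter> Z = {}"
  proof -
    have "e \<inter> e' = {}" if "e \<in> A" "e' \<in> B - A" for e e'
      using arcs_meet[of e e'] assms(3)[of e e'] assms(1) that by blast
    then show ?thesis
      by blast
  qed
  ultimately have "\<Union>A \<inter> Z = {} \<or> \<Union>(B - A) \<inter> Z = {}"
    unfolding connected_closed by blast
  moreover obtain e e' where "e \<in> A" "e' \<in> B - A"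
    using assms(1,2) \<open>A \<noteq> B\<close> by blast
  moreover have "e \<noteq> {}" if "e \<in> B" for e
    using arc_facts(3)[OF that] by auto
  ultimately show False
    using circle_eq assms(1) by blast
qed

end

section \<open>Faces of planar tessellations\<close>

context planar_tessellation
begin

lemma closed_face_sub: "closed_face S f \<subseteq> S"
  using closure_of_subset_topspace[of "top_of_set S"] by (simp add: closed_face_def)

lemma vertex_on_edge:
  assumes "x \<in> V"
  obtains e where "e \<in> E" "x \<in> e"
proof -
  have "{e \<in> E. x \<in> e} \<noteq> {}"
    using vertex_degree_ge_3[OF assms] unfolding vertex_degree_def by (metis card.empty not_numeral_le_zero)
  then show thesis
    using that by blast
qed

lemma face_chart:
  assumes "f \<in> faces S V E"
  obtains h k where "homeomorphism (cball (0::real^2) 1) (closed_face S f) h k"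
  using closed_face_disk[OF assms] homeomorphic_sym unfolding homeomorphic_def by blast

lemmas face_disk = closed_disk_in_two_manifold[OF two_manifold_sphere_or_plane[OF surface] closed_face_sub]

text \<open>
  An edge through the open disk of a closed face would also lie in a second closed face, and the
  two closed faces would share a nonempty open set, which cannot be contained in an arc.
\<close>

lemma open_disk_disjoint_edges:
  assumes f: "f \<in> faces S V E" and hk: "homeomorphism (cball (0::real^2) 1) (closed_face S f) h k"
  shows "h ` ball 0 1 \<inter> \<Union>E = {}"
proof (rule ccontr)
  assume "h ` ball 0 1 \<inter> \<Union>E \<noteq> {}"
  then obtain p e where p: "p \<in> h ` ball 0 1" "p \<in> e" "e \<in> E"
    by blast
  have "\<exists>g\<in>{f \<in> faces S V E. e \<subseteq> closed_face S f}. g \<noteq> f"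
    using card_2_other[OF edge_in_two_faces[OF p(3)]] .
  then obtain g where g: "g \<in> faces S V E" "g \<noteq> f" "e \<subseteq> closed_face S g"
    by blast
  obtain h' k' where hk': "homeomorphism (cball (0::real^2) 1) (closed_face S g) h' k'"
    using face_chart[OF g(1)] .
  have op: "openin (top_of_set S) (h ` ball 0 1)"
    using face_disk(1)[OF hk] .
  define W where "W = ball 0 1 \<inter> h' -` (h ` ball 0 1)"
  have cont: "continuous_on (cball 0 1) h'" and inj: "inj_on h' (cball 0 1)" and im: "h' ` cball 0 1 = closed_face S g"
    using hk' by (auto simp: homeomorphism_def intro: inj_on_inverseI[of _ k'])
  obtain X where X: "open X" "h ` ball 0 1 = S \<inter> X"
    using op by (auto simp: openin_open)
  have sub: "ball (0::real^2) 1 \<subseteq> cball 0 1"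
    by auto
  have W: "W = ball 0 1 \<inter> h' -` X"
  proof -
    have "h' z \<in> S" if "z \<in> ball 0 1" for z
      using that im closed_face_sub[of g] by (metis image_subset_iff subsetD sub)
    then show ?thesis
      using X(2) by (auto simp: W_def)
  qed
  have "open W"
    unfolding W using cont X(1) sub
    by (intro continuous_open_preimage) (auto intro: continuous_on_subset)
  \<comment> \<open>The point \<open>p\<close> may lie on the rim of the disk of \<open>g\<close>.
    Its preimage \<open>z\<close> is still in the closure of the open ball, so every neighbourhood
    of \<open>z\<close> meets that ball.\<close>
  have "W \<noteq> {}"
  proof -
    obtain z where z: "z \<in> cball 0 1" "h' z = p"
      using im g(3) p(2) by (metis imageE subsetD)
    have "openin (top_of_set (cball 0 1)) (cball 0 1 \<inter> h' -` X)"
      using cont X(1) by (rule continuous_openin_preimage_gen)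
    then obtain Y where Y: "open Y" "cball 0 1 \<inter> h' -` X = cball 0 1 \<inter> Y"
      by (auto simp: openin_open)
    have "z \<in> Y"
      using z p(1) X(2) Y(2) by blast
    moreover have "z \<in> closure (ball 0 1)"
      using z(1) by simp
    ultimately have "ball 0 1 \<inter> Y \<noteq> {}"
      using Y(1) by (metis IntI emptyE inf_commute open_Int_closure_eq_empty)
    then show ?thesis
      unfolding W using Y(2) sub by blast
  qed
  have W_sub: "h' ` W \<subseteq> closed_face S f \<inter> closed_face S g"
  proof -
    have "h ` ball 0 1 \<subseteq> closed_face S f"
      using hk sub by (auto simp: homeomorphism_def)
    moreover have "h' ` W \<subseteq> h' ` cball 0 1"
      using sub by (intro image_mono) (auto simp: W_def)
    ultimately show ?thesis
      unfolding im by (auto simp: W_def)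
  qed
  have contW: "continuous_on W h'" and injW: "inj_on h' W"
    using cont inj sub by (auto simp: W_def intro: continuous_on_subset inj_on_subset)
  have "infinite W"
    using \<open>open W\<close> \<open>W \<noteq> {}\<close> finite_imp_not_open by blast
  then have "infinite (h' ` W)"
    using finite_imageD[OF _ injW] by blast
  then have "infinite (closed_face S f \<inter> closed_face S g)"
    using W_sub finite_subset by blast
  then obtain e' where "e' \<in> E" "closed_face S f \<inter> closed_face S g = e'"
    using faces_intersect[OF f g(1)] g(2) by fastforce
  moreover then obtain c where "arc c" "path_image c = e'"
    using edge_arc by blast
  ultimately show False
    using no_open_set_in_arc[OF _ \<open>open W\<close> contW injW] W_sub \<open>W \<noteq> {}\<close> by blast
qed

lemma closed_face_Int_edges:
  assumes f: "f \<in> faces S V E"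
  shows "closed_face S f \<inter> \<Union>E \<subseteq> face_boundary S f"
proof -
  obtain h k where hk: "homeomorphism (cball (0::real^2) 1) (closed_face S f) h k"
    using face_chart[OF f] .
  have "closed_face S f = h ` cball 0 1"
    using hk by (simp add: homeomorphism_def)
  also have "cball (0::real^2) 1 = ball 0 1 \<union> sphere 0 1"
    by auto
  finally show ?thesis
    using open_disk_disjoint_edges[OF f hk] face_disk(2)[OF hk] unfolding face_boundary_def by blast
qed

text \<open>Reconciles two conventions: \<open>edge_in_two_faces\<close> counts closed faces that
  contain the edge, while \<open>face_degree\<close> counts edges inside the frontier.\<close>

lemma boundary_edges_iff:
  assumes "f \<in> faces S V E" "e \<in> E"
  shows "e \<in> boundary_edges S E f \<longleftrightarrow> e \<subseteq> closed_face S f"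
proof
  assume "e \<in> boundary_edges S E f"
  moreover have "face_boundary S f \<subseteq> closed_face S f"
    unfolding face_boundary_def closed_face_def
    by (metis closedin_closure_of frontier_of_subset_closedin)
  ultimately show "e \<subseteq> closed_face S f"
    by (auto simp: boundary_edges_def)
next
  assume "e \<subseteq> closed_face S f"
  then show "e \<in> boundary_edges S E f"
    using closed_face_Int_edges[OF assms(1)] assms(2) by (auto simp: boundary_edges_def)
qed

text \<open>Since degrees are at least 3, every vertex lies on an edge and hence outside the open
  disk of the face.\<close>

lemma closed_face_Int_vertices:
  assumes "f \<in> faces S V E"
  shows "closed_face S f \<inter> V = (\<Union>e\<in>boundary_edges S E f. e \<inter> V)"
proof
  show "closed_face S f \<inter> V \<subseteq> (\<Union>e\<in>boundary_edges S E f. e \<inter> V)"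
  proof
    fix x assume x: "x \<in> closed_face S f \<inter> V"
    then obtain e where "e \<in> E" "x \<in> e"
      using vertex_on_edge by blast
    then have "x \<in> face_boundary S f"
      using closed_face_Int_edges[OF assms] x by blast
    then show "x \<in> (\<Union>e\<in>boundary_edges S E f. e \<inter> V)"
      using face_boundary_edges[OF assms] x by auto
  qed
  show "(\<Union>e\<in>boundary_edges S E f. e \<inter> V) \<subseteq> closed_face S f \<inter> V"
    using boundary_edges_iff[OF assms] by (auto simp: boundary_edges_def)
qed

lemma circle_of_boundary_edges:
  assumes "f \<in> faces S V E"
  shows "circle_of_arcs (face_boundary S f) V (boundary_edges S E f)"
proof
  obtain h k where hk: "homeomorphism (cball (0::real^2) 1) (closed_face S f) h k"
    using face_chart[OF assms] .
  have "face_boundary S f = h ` sphere 0 1"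
    unfolding face_boundary_def by (rule face_disk(2)[OF hk])
  then have "homeomorphism (sphere 0 1) (face_boundary S f) h k"
    using homeomorphism_of_subsets[OF hk, of "sphere 0 1"] by auto
  then show "face_boundary S f homeomorphic (sphere 0 1 :: (real^2) set)"
    using homeomorphic_sym homeomorphic_def by blast
  show "3 \<le> card (boundary_edges S E f)"
    using face_degree_ge_3[OF assms] by (simp add: face_degree_def)
  show "finite (boundary_edges S E f)" "face_boundary S f = \<Union>(boundary_edges S E f)"
    using face_boundary_edges[OF assms] by auto
  show "\<exists>g. arc g \<and> path_image g = e \<and> e \<inter> V = {pathstart g, pathfinish g}" 
    if "e \<in> boundary_edges S E f" for e
    using that edge_arc by (auto simp: boundary_edges_def)
  show "e \<inter> e' \<subseteq> V" if "e \<in> boundary_edges S E f" "e' \<in> boundary_edges S E f" "e \<noteq> e'" for e e'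
    using that edges_meet_in_vertices by (auto simp: boundary_edges_def)
qed

text \<open>The passage from topology to combinatorics: arcs are replaced by their end sets, which
  loses nothing because the graph is simple.\<close>

lemma four_regular_complex:
  assumes "\<And>x. x \<in> V \<Longrightarrow> vertex_degree E x = 4"
  shows "four_regular_complex V ((\<lambda>e. e \<inter> V) ` E) (faces S V E)
    (\<lambda>f. (\<lambda>e. e \<inter> V) ` boundary_edges S E f)"
proof
  let ?G = "(\<lambda>e. e \<inter> V) ` E" and ?bd = "\<lambda>f. (\<lambda>e. e \<inter> V) ` boundary_edges S E f"
  have be: "boundary_edges S E f \<subseteq> E" for f
    by (auto simp: boundary_edges_def)
  show "e \<subseteq> V" if "e \<in> ?G" for e
    using that by blast
  show card_e: "card e = 2" if e: "e \<in> ?G" for e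
  proof -
    obtain c where "c \<in> E" "e = c \<inter> V"
      using e by blast
    then obtain g where "arc g" "e = {pathstart g, pathfinish g}"
      using edge_arc by blast
    then show ?thesis
      using arc_distinct_ends[of g] by simp
  qed
  show "card {e \<in> ?G. x \<in> e} = 4" if "x \<in> V" for x
  proof -
    have "{e \<in> ?G. x \<in> e} = (\<lambda>e. e \<inter> V) ` {e \<in> E. x \<in> e}"
      using that by blast
    moreover have "inj_on (\<lambda>e. e \<inter> V) {e \<in> E. x \<in> e}"
      using no_multiple_edges by (rule inj_on_subset) blast
    ultimately show ?thesis
      using assms[OF that] by (simp add: card_image vertex_degree_def)
  qed
  show "(x, y) \<in> {(x, y). {x, y} \<in> ?G}\<^sup>*" if "x \<in> V" "y \<in> V" for x y
  proof -
    have "adjacency V E \<subseteq> {(x, y). {x, y} \<in> ?G}"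
      by (auto simp: adjacency_def intro: rev_image_eqI)
    then show ?thesis
      using connected_graph[OF that] rtrancl_mono by blast
  qed
  show two_faces: "card {f \<in> faces S V E. e \<in> ?bd f} = 2" if e: "e \<in> ?G" for e
  proof -
    obtain c where c: "c \<in> E" "e = c \<inter> V"
      using e by blast
    have "e \<in> ?bd f \<longleftrightarrow> c \<subseteq> closed_face S f" if "f \<in> faces S V E" for f
    proof -
      have "e \<in> ?bd f \<longleftrightarrow> c \<in> boundary_edges S E f"
        unfolding c(2) using inj_on_image_mem_iff[OF no_multiple_edges c(1) be] .
      then show ?thesis
        using boundary_edges_iff[OF that c(1)] by simp
    qed
    then have "{f \<in> faces S V E. e \<in> ?bd f} = {f \<in> faces S V E. c \<subseteq> closed_face S f}"
      by blast
    then show ?thesis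
      using edge_in_two_faces[OF c(1)] by simp
  qed
  fix f assume f: "f \<in> faces S V E"
  interpret circle_of_arcs "face_boundary S f" V "boundary_edges S E f"
    by (rule circle_of_boundary_edges[OF f])
  show "?bd f \<subseteq> ?G"
    using be by blast
  show "finite (?bd f)"
    using finite_arcs by blast
  show "?bd f \<noteq> {}"
    using card_arcs by auto
  show "card {e \<in> ?bd f. x \<in> e} = 2" if "x \<in> \<Union>(?bd f)" for x
  proof -
    have x: "x \<in> V" "x \<in> face_boundary S f"
      using that circle_eq by auto
    have "{e \<in> ?bd f. x \<in> e} = (\<lambda>e. e \<inter> V) ` {e \<in> boundary_edges S E f. x \<in> e}"
      using x by blast
    moreover have "inj_on (\<lambda>e. e \<inter> V) {e \<in> boundary_edges S E f. x \<in> e}"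
      using no_multiple_edges by (rule inj_on_subset) (use be in blast)
    ultimately show ?thesis
      using card_arcs_at_vertex[OF x(2,1)] by (simp add: card_image)
  qed
  show "A = ?bd f" if A: "A \<subseteq> ?bd f" "A \<noteq> {}"
      and closed: "\<And>e e'. e \<in> A \<Longrightarrow> e' \<in> ?bd f \<Longrightarrow> e \<inter> e' \<noteq> {} \<Longrightarrow> e' \<in> A" for A
  proof -
    define A' where "A' = {e \<in> boundary_edges S E f. e \<inter> V \<in> A}"
    have "A' = boundary_edges S E f"
    proof (rule connected_circle_of_arcs)
      show "A' \<noteq> {}"
        using A by (auto simp: A'_def)
      show "e' \<in> A'" if "e \<in> A'" "e' \<in> boundary_edges S E f" "e \<inter> e' \<inter> V \<noteq> {}" for e e'
        using closed[of "e \<inter> V" "e' \<inter> V"] that by (auto simp: A'_def)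
    qed (auto simp: A'_def)
    then show ?thesis
      using A(1) by (auto simp: A'_def)
  qed
  show "card (\<Union>(?bd f) \<inter> \<Union>(?bd g)) \<le> 2" if g: "g \<in> faces S V E" "f \<noteq> g" for g
  proof -
    have eq: "\<Union>(?bd f) \<inter> \<Union>(?bd g) = closed_face S f \<inter> closed_face S g \<inter> V"
      using closed_face_Int_vertices[OF f] closed_face_Int_vertices[OF g(1)] by blast
    consider "closed_face S f \<inter> closed_face S g = {}"
      | v where "closed_face S f \<inter> closed_face S g = {v}"
      | e where "e \<in> E" "closed_face S f \<inter> closed_face S g = e"
      using faces_intersect[OF f g] by blast
    then show ?thesis
    proof cases
      case 1
      then show ?thesis
        unfolding eq by simp
    next
      case 2
      then show ?thesis
        unfolding eq by (auto simp: Int_insert_left)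
    next
      case 3
      then show ?thesis
        unfolding eq using card_e[of "closed_face S f \<inter> closed_face S g \<inter> V"] by auto
    qed
  qed
qed

section \<open>Covering the surface by closed faces\<close>

lemma surface_eq_Union_closed_faces:
  "S = (\<Union>f\<in>faces S V E. closed_face S f)"
proof
  show "S \<subseteq> (\<Union>f\<in>faces S V E. closed_face S f)"
  proof
    fix x assume x: "x \<in> S"
    show "x \<in> (\<Union>f\<in>faces S V E. closed_face S f)"
    proof (cases "x \<in> V \<union> \<Union>E")
      case True
      then obtain e where e: "e \<in> E" "x \<in> e"
        using vertex_on_edge by blast
      then obtain f where "f \<in> faces S V E" "e \<subseteq> closed_face S f"
        using card_2_other[OF edge_in_two_faces[OF e(1)]] by blast
      then show ?thesis
        using e by blast
    next
      case False
      then obtain f where f: "f \<in> faces S V E" "x \<in> f"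
        using x Union_components[of "S - (V \<union> \<Union>E)"] unfolding faces_def by blast
      then have "f \<subseteq> S"
        unfolding faces_def using in_components_subset by blast
      then have "f \<subseteq> closed_face S f"
        unfolding closed_face_def by (intro closure_of_subset) simp
      then show ?thesis
        using f by blast
    qed
  qed
qed (use closed_face_sub in blast)

lemma two_sphere_if_finitely_many_faces:
  assumes "finite (faces S V E)"
  shows "is_two_sphere S"
proof -
  have "compact (closed_face S f)" if "f \<in> faces S V E" for f
    using closed_face_disk[OF that] homeomorphic_compactness compact_cball by blast
  then have "compact S"
    by (subst surface_eq_Union_closed_faces) (use assms in \<open>blast intro: compact_UN\<close>)
  moreover have "\<not> compact S" if "is_plane S"
    using that compact_imp_bounded not_bounded_UNIV by (auto simp: is_plane_def)
  ultimately show ?thesis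
    using surface by blast
qed

end

section \<open>Curvature estimate and conclusion\<close>

lemma triangle_of_curvature:
  assumes "card A = 4" "s \<in> A" "13 \<le> d s" "\<And>f. f \<in> A \<Longrightarrow> 3 \<le> d f"
    and sum: "(\<Sum>f\<in>A. 1 / real (d f)) \<ge> 1" and g: "g \<in> A" "g \<noteq> s"
  shows "d g = (3::nat)"
proof (rule ccontr)
  assume "d g \<noteq> 3"
  then have "4 \<le> d g"
    using assms(4)[OF g(1)] by simp
  have fin: "finite A"
    using assms(1) by (metis card.infinite zero_neq_numeral)
  have "(\<Sum>f\<in>A. 1 / real (d f)) = 1 / d s + (1 / d g + (\<Sum>f\<in>A - {s} - {g}. 1 / real (d f)))"
    using fin assms(2) g by (simp add: sum.remove[of A s] sum.remove[of "A - {s}" g])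
  also have "(\<Sum>f\<in>A - {s} - {g}. 1 / real (d f)) \<le> (\<Sum>f\<in>A - {s} - {g}. 1 / 3)"
    using assms(4) by (intro sum_mono divide_left_mono) force+
  also have "\<dots> = 2 / 3"
    using assms(1,2) g fin by (simp add: card_Diff_singleton)
  also have "1 / real (d s) \<le> 1 / 13"
    using assms(3) by (intro divide_left_mono) auto
  also have "1 / real (d g) \<le> 1 / 4"
    using \<open>4 \<le> d g\<close> by (intro divide_left_mono) auto
  finally show False
    using sum by simp
qed

theorem theorem3p1:
  fixes S :: "'a::euclidean_space set" and V :: "'a set" and E :: "'a set set"
  assumes "planar_tessellation S V E"
    and "\<And>x. x \<in> V \<Longrightarrow> vertex_degree E x = 4"
    and "\<And>x. x \<in> V \<Longrightarrow> curvature S V E x \<ge> 0"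
    and "(SUP f \<in> faces S V E. enat (face_degree S E f)) \<ge> 13"
  shows "finite V \<and> finite E \<and> finite (faces S V E) \<and> is_two_sphere S \<and> is_antiprism S V E"
proof -
  interpret planar_tessellation S V E
    by (rule assms(1))
  let ?bd = "\<lambda>f. (\<lambda>e. e \<inter> V) ` boundary_edges S E f" and ?F = "faces S V E"
  interpret four_regular_complex V "(\<lambda>e. e \<inter> V) ` E" ?F ?bd
    by (rule four_regular_complex) (rule assms(2))
  have verts: "\<Union>(?bd f) = closed_face S f \<inter> V" if "f \<in> ?F" for f
    using closed_face_Int_vertices[OF that] by simp
  have card_bd: "card (?bd f) = face_degree S E f" for f
    unfolding face_degree_def
    by (intro card_image inj_on_subset[OF no_multiple_edges]) (auto simp: boundary_edges_def)
  \<comment> \<open>The degrees are integers: were all of them at most 12, so would be their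
    supremum. Hence a face with at least 13 edges exists even if the supremum is not
    attained.\<close>
  obtain s where s: "s \<in> ?F" "13 \<le> face_degree S E s"
  proof (rule ccontr)
    assume "\<not> thesis"
    then have "face_degree S E f \<le> 12" if "f \<in> ?F" for f
      using \<open>\<And>s. s \<in> ?F \<Longrightarrow> 13 \<le> face_degree S E s \<Longrightarrow> thesis\<close>[OF that] by linarith
    then have "(SUP f \<in> ?F. enat (face_degree S E f)) \<le> enat 12"
      by (intro SUP_least) simp
    then have "(13::enat) \<le> enat 12"
      using assms(4) order_trans by blast
    then show False
      by (simp add: numeral_eq_enat)
  qed
  have triangles: "card (?bd f) = 3" if f: "f \<in> ?F" "f \<noteq> s" and meet: "\<Union>(?bd f) \<inter> \<Union>(?bd s) \<noteq> {}" for f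
  proof -
    obtain x where x: "x \<in> V" "x \<in> \<Union>(?bd f)" "x \<in> \<Union>(?bd s)"
      using meet by blast
    let ?A = "{f \<in> ?F. x \<in> closed_face S f}"
    have "?A = {f \<in> ?F. x \<in> \<Union>(?bd f)}"
      using verts x(1) by blast
    then have "card ?A = 4"
      using card_faces_at_vertex[OF x(1)] by simp
    \<comment> \<open>At degree 4 the curvature is this sum minus 1.\<close>
    moreover have "(\<Sum>f\<in>?A. 1 / real (face_degree S E f)) \<ge> 1"
      using assms(3)[OF x(1)] assms(2)[OF x(1)] by (simp add: curvature_def)
    moreover have "s \<in> ?A" "f \<in> ?A"
      using x f s verts by blast+
    ultimately have "face_degree S E f = 3"
      using s(2) f(2) face_degree_ge_3 by (intro triangle_of_curvature[of ?A s]) auto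
    then show ?thesis
      by (simp add: card_bd)
  qed
  obtain n a b where
    n: "n \<ge> 3" "inj_on a {..<n}" "inj_on b {..<n}" "a ` {..<n} \<inter> b ` {..<n} = {}"
      "V = a ` {..<n} \<union> b ` {..<n}"
    and G: "(\<lambda>e. e \<inter> V) ` E =
      (\<Union>i<n. {{a i, a (Suc i mod n)}, {b i, b (Suc i mod n)}, {a i, b i}, {a (Suc i mod n), b i}})"
    and F: "(\<lambda>f. \<Union>(?bd f)) ` ?F = {a ` {..<n}, b ` {..<n}} \<union>
       (\<Union>i<n. {{a i, a (Suc i mod n), b i}, {a (Suc i mod n), b i, b (Suc i mod n)}})"
    by (rule antiprism_structure[OF s(1) triangles])
  have "finite V"
    using n(5) by simp
  have "finite ((\<lambda>e. e \<inter> V) ` E)"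
    unfolding G by simp
  then have "finite E"
    using no_multiple_edges finite_imageD by blast
  have "finite ((\<lambda>f. \<Union>(?bd f)) ` ?F)"
    unfolding F by simp
  then have "finite ?F"
    using vertices_inj finite_imageD by blast
  then have "is_two_sphere S"
    by (rule two_sphere_if_finitely_many_faces)
  have "bij_betw (\<lambda>f. \<Union>(?bd f)) ?F ({a ` {..<n}, b ` {..<n}} \<union>
       (\<Union>i<n. {{a i, a (Suc i mod n), b i}, {a (Suc i mod n), b i, b (Suc i mod n)}}))"
    using vertices_inj F by (rule bij_betw_imageI)
  then have "bij_betw (\<lambda>f. closed_face S f \<inter> V) ?F ({a ` {..<n}, b ` {..<n}} \<union>
       (\<Union>i<n. {{a i, a (Suc i mod n), b i}, {a (Suc i mod n), b i, b (Suc i mod n)}}))"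
    by (subst (asm) bij_betw_cong[OF verts])
  moreover have "bij_betw (\<lambda>e. e \<inter> V) E
      (\<Union>i<n. {{a i, a (Suc i mod n)}, {b i, b (Suc i mod n)}, {a i, b i}, {a (Suc i mod n), b i}})"
    using no_multiple_edges G by (rule bij_betw_imageI)
  ultimately have "is_antiprism S V E"
    unfolding is_antiprism_def using assms(1) \<open>is_two_sphere S\<close> n by blast
  then show ?thesis
    using \<open>finite V\<close> \<open>finite E\<close> \<open>finite ?F\<close> \<open>is_two_sphere S\<close> by blast
qed

end
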